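(* Let $\beta>0$, $0\le k_0<k_1$ and $\alpha,\varepsilon\in\mathbb{R}$ with $\alpha(1-\beta)\neq0$, and set $$\alpha^L_{\beta,\varepsilon}=\frac{-(1+k_0)\big(\beta(\varepsilon-1)+k_0\varepsilon\big)}{k_0+\beta},\qquad \alpha^R_{\beta,\varepsilon}=\frac{-(1+k_1)\big(\beta(\varepsilon-1)+k_1\varepsilon\big)}{k_1+\beta}.$$ Suppose that $\alpha<\alpha^L_{\beta,\varepsilon}$ and $\alpha>\alpha^R_{\beta,\varepsilon}$. Then, for the piecewise smooth Welander system in canonical form (given in the context), the following hold: (1) If the discontinuity line $\Sigma=\{x=0\}$ contains a sliding segment (that is, $\varepsilon>0$), or contains neither a sliding nor an escaping segment (that is, $\varepsilon=0$), then the system does not have crossing periodic orbits. (2) If $\Sigma$ contains an escaping segment (that is, $\varepsilon<0$), then the system has a unique crossing periodic orbit; it is stable and it surrounds the escaping segment $\{(0,y): 0<y<(k_0-k_1)\varepsilon\}$.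
   Context: Canonical form of the piecewise smooth Welander system (for $\alpha(1-\beta)\ne0$): put $$a^L=-\alpha(k_0+\beta)-(1+k_0)\big(\beta(\varepsilon-1)+k_0\varepsilon\big),\qquad a^R=-\alpha(k_1+\beta)-(1+k_1)\big(\beta(\varepsilon-1)+k_1\varepsilon\big).$$ The system on $\mathbb{R}^2$ is governed for $x<0$ by the left vector field $$Z^L(x,y)=\big(-(1+2k_0+\beta)x-y,\ (1+k_0)(k_0+\beta)x-a^L\big)$$ and for $x>0$ by the right vector field $$Z^R(x,y)=\big(-(1+2k_1+\beta)x-y+(k_0-k_1)\varepsilon,\ (1+k_1)(k_1+\beta)x-a^R\big),$$ with discontinuity line $\Sigma=\{x=0\}$. Let $Z^L_1,Z^R_1$ denote first components. A point $p\in\Sigma$ is a crossing point if $Z^L_1(p)Z^R_1(p)>0$, a sliding point if $Z^R_1(p)<0<Z^L_1(p)$, and an escaping point if $Z^L_1(p)<0<Z^R_1(p)$; sliding (escaping) segments are segments of $\Sigma$ consisting of sliding (escaping) points. Solutions through crossing points are obtained by concatenating arcs of solutions of $Z^L$ and $Z^R$. A crossing periodic orbit is a closed orbit, made of arcs of trajectories of $Z^L$ in $\{x<0\}$ and of $Z^R$ in $\{x>0\}$, which meets $\Sigma$ in a nonempty finite set of points, all of which are crossing points. It is stable if the orbits starting sufficiently near it converge to it in forward time, and it surrounds a set if that set lies in the bounded component of the complement of the (Jordan) closed orbit. *)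

theory Defs
  imports "HOL-Analysis.Analysis"
begin

type_synonym planar_field = "real \<times> real \<Rightarrow> real \<times> real"

text \<open>General planar piecewise smooth systems: \<open>X\<close> governs \<open>x < 0\<close> and \<open>Y\<close> governs \<open>x > 0\<close>.\<close>

definition switching_line :: "(real \<times> real) set" where
  "switching_line = {p. fst p = 0}"

definition crossing_points :: "planar_field \<Rightarrow> planar_field \<Rightarrow> (real \<times> real) set" where
  "crossing_points X Y = {p \<in> switching_line. fst (X p) * fst (Y p) > 0}"

definition sliding_points :: "planar_field \<Rightarrow> planar_field \<Rightarrow> (real \<times> real) set" where
  "sliding_points X Y = {p \<in> switching_line. fst (Y p) < 0 \<and> 0 < fst (X p)}"

definition escaping_points :: "planar_field \<Rightarrow> planar_field \<Rightarrow> (real \<times> real) set" where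
  "escaping_points X Y = {p \<in> switching_line. fst (X p) < 0 \<and> 0 < fst (Y p)}"

definition contains_segment :: "(real \<times> real) set \<Rightarrow> bool" where
  "contains_segment S \<longleftrightarrow> (\<exists>p q. p \<noteq> q \<and> open_segment p q \<subseteq> S)"

text \<open>
  A concatenation of arcs of \<open>X\<close> and \<open>Y\<close> through crossing points. The last conjunct makes the
  crossing times locally finite; without it, a curve resting at a crossing point would satisfy
  the other conditions vacuously. No derivative is prescribed at the crossing times: there the
  one-sided derivatives are forced by continuity and the equations on the adjacent arcs.
\<close>

definition crossing_solution ::
  "planar_field \<Rightarrow> planar_field \<Rightarrow> real set \<Rightarrow> (real \<Rightarrow> real \<times> real) \<Rightarrow> bool" where
  "crossing_solution X Y I \<gamma> \<longleftrightarrow>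
     continuous_on I \<gamma> \<and>
     (\<forall>t\<in>I. fst (\<gamma> t) < 0 \<longrightarrow> (\<gamma> has_vector_derivative X (\<gamma> t)) (at t within I)) \<and>
     (\<forall>t\<in>I. fst (\<gamma> t) > 0 \<longrightarrow> (\<gamma> has_vector_derivative Y (\<gamma> t)) (at t within I)) \<and>
     (\<forall>t\<in>I. \<gamma> t \<in> switching_line \<longrightarrow> \<gamma> t \<in> crossing_points X Y) \<and>
     (\<forall>a b. {a..b} \<subseteq> I \<longrightarrow> finite {t \<in> {a..b}. \<gamma> t \<in> switching_line})"

text \<open>
  Orbits are point sets. The period \<open>T\<close> need not be minimal. The curve is automatically
  non-constant, and by uniqueness of solutions off the switching line and through crossing
  points its range is a Jordan curve.
\<close>

definition crossing_periodic_orbit ::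
  "planar_field \<Rightarrow> planar_field \<Rightarrow> (real \<times> real) set \<Rightarrow> bool" where
  "crossing_periodic_orbit X Y \<Gamma> \<longleftrightarrow>
     (\<exists>\<gamma> T. T > 0 \<and> crossing_solution X Y UNIV \<gamma> \<and> (\<forall>t. \<gamma> (t + T) = \<gamma> t) \<and> \<Gamma> = range \<gamma>) \<and>
     \<Gamma> \<inter> switching_line \<noteq> {} \<and> finite (\<Gamma> \<inter> switching_line)"

text \<open>
  The existence of a forward solution is part of the definition, so that convergence is not
  vacuous at any nearby initial point.
\<close>

definition stable_orbit :: "planar_field \<Rightarrow> planar_field \<Rightarrow> (real \<times> real) set \<Rightarrow> bool" where
  "stable_orbit X Y \<Gamma> \<longleftrightarrow>
     (\<exists>\<delta>>0. \<forall>p. infdist p \<Gamma> < \<delta> \<longrightarrow>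
        (\<exists>\<gamma>. crossing_solution X Y {0..} \<gamma> \<and> \<gamma> 0 = p) \<and>
        (\<forall>\<gamma>. crossing_solution X Y {0..} \<gamma> \<and> \<gamma> 0 = p \<longrightarrow>
           ((\<lambda>t. infdist (\<gamma> t) \<Gamma>) \<longlongrightarrow> 0) at_top))"

text \<open>For a Jordan curve \<open>\<Gamma>\<close>, \<open>inside \<Gamma>\<close> is the bounded component of its complement.\<close>

definition surrounds :: "(real \<times> real) set \<Rightarrow> (real \<times> real) set \<Rightarrow> bool" where
  "surrounds \<Gamma> S \<longleftrightarrow> S \<subseteq> inside \<Gamma>"

text \<open>
  The Welander system in canonical form. The left and right constants are given by the same
  expression in \<open>k\<close>, evaluated at \<open>k0\<close> and \<open>k1\<close> respectively.
\<close>

definition welander_a :: "real \<Rightarrow> real \<Rightarrow> real \<Rightarrow> real \<Rightarrow> real" where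
  "welander_a \<alpha> \<beta> \<epsilon> k = - \<alpha> * (k + \<beta>) - (1 + k) * (\<beta> * (\<epsilon> - 1) + k * \<epsilon>)"

definition welander_alpha :: "real \<Rightarrow> real \<Rightarrow> real \<Rightarrow> real" where
  "welander_alpha \<beta> \<epsilon> k = - (1 + k) * (\<beta> * (\<epsilon> - 1) + k * \<epsilon>) / (k + \<beta>)"

definition welander_L :: "real \<Rightarrow> real \<Rightarrow> real \<Rightarrow> real \<Rightarrow> planar_field" where
  "welander_L \<alpha> \<beta> \<epsilon> k0 = (\<lambda>(x, y).
     (- (1 + 2 * k0 + \<beta>) * x - y,
      (1 + k0) * (k0 + \<beta>) * x - welander_a \<alpha> \<beta> \<epsilon> k0))"

definition welander_R :: "real \<Rightarrow> real \<Rightarrow> real \<Rightarrow> real \<Rightarrow> real \<Rightarrow> planar_field" where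
  "welander_R \<alpha> \<beta> \<epsilon> k0 k1 = (\<lambda>(x, y).
     (- (1 + 2 * k1 + \<beta>) * x - y + (k0 - k1) * \<epsilon>,
      (1 + k1) * (k1 + \<beta>) * x - welander_a \<alpha> \<beta> \<epsilon> k1))"

end

theory Submission
  imports Defs
begin

text \<open>
  Put \<open>p = 1 + k\<close>, \<open>q = k + \<beta>\<close>. Each of the two fields is an affine stable node with eigenvalues
  \<open>- p\<close> and \<open>- q\<close>, which differ because \<open>\<beta> \<noteq> 1\<close>, and the inequalities on \<open>\<alpha>\<close> say that both
  equilibria are virtual: the left one lies in \<open>x > 0\<close>, the right one in \<open>x < 0\<close>. The half-turn
  \<open>(x, y) \<mapsto> (- x, s - y)\<close> with \<open>s = (k0 - k1) \<epsilon>\<close> carries the right half system into the left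
  normal form (\<open>node.field\<close>), so that a single kind of half-plane arc has to be understood.
  The segment between \<open>(0, 0)\<close> and \<open>(0, s)\<close> is escaping for \<open>s > 0\<close>, sliding for \<open>s < 0\<close> and
  degenerate for \<open>s = 0\<close>.

  An arc in \<open>x < 0\<close> leaves the line at \<open>(0, y)\<close> with \<open>y > 0\<close> and, the equilibrium being virtual,
  returns at some \<open>(0, - transit y)\<close>. The half return map \<open>transit\<close> has no closed form, but its
  graph does when it is parametrised by the duration \<open>t\<close> of the arc: the arc starts at height
  \<open>height t\<close> and lands at height \<open>height (- t)\<close> for one and the same explicit function. Because the
  divergence \<open>- (p + q)\<close> is negative, comparing the two ends gives \<open>0 < transit y < y\<close>, and
  comparing their derivatives in \<open>t\<close> shows that \<open>transit\<close> is increasing and strictly contracting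
  (\<open>transit_less\<close>, \<open>transit_contracts\<close>). It is moreover bounded.

  The return map to the upper crossing points is
  \<open>return y = s + transit\<^sub>R (s + transit\<^sub>L y)\<close>. If \<open>s \<le> 0\<close> then \<open>return y < y\<close>, which rules out
  periodic orbits (\<open>no_periodic_orbit\<close>). If \<open>s > 0\<close> it is a strict contraction that maps an interval
  \<open>{s..B}\<close> into itself, so it has exactly one fixed point, to which all iterates converge. The turn
  through the fixed point is the only crossing periodic orbit (\<open>limit_cycle_is_periodic_orbit\<close>,
  \<open>periodic_orbit_unique\<close>). Arcs depend continuously on their starting point, so every solution
  approaches this orbit (\<open>stable_limit_cycle\<close>). Its two arcs are graphs over the line \<open>x = 0\<close>,
  one in \<open>x < 0\<close> and one in \<open>x > 0\<close>, and they enclose the escaping segment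
  (\<open>limit_cycle_surrounds\<close>).

  Passing between orbits as curves and the return map needs two facts about crossing solutions:
  any solution follows the explicit arcs (\<open>sol_follows_left_arc\<close>), and explicit arcs glue to
  solutions for all time, since for \<open>s > 0\<close> their durations are bounded below
  (\<open>crossing_solution_forever\<close>).
\<close>

section \<open>Affine stable nodes and their half return maps\<close>

lemma first_zero:
  fixes g :: "real \<Rightarrow> real"
  assumes "a < d" and neg: "\<And>t. a < t \<Longrightarrow> t < d \<Longrightarrow> g t < 0"
    and cont: "continuous_on {a..b} g" and "a < b" "0 \<le> g b"
  obtains c where "a < c" "c \<le> b" "g c = 0" "\<And>t. a < t \<Longrightarrow> t < c \<Longrightarrow> g t < 0"
proof -
  define e where "e = (a + min b d) / 2"
  have e: "a < e" "e < b" "e < d" using assms by (auto simp: e_def min_def)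
  have zero: "\<exists>r. e \<le> r \<and> r \<le> t \<and> g r = 0" if "e \<le> t" "t \<le> b" "0 \<le> g t" for t
  proof -
    have "g e \<le> 0" using neg[of e] e by simp
    moreover have "continuous_on {e..t} g" using continuous_on_subset[OF cont] e that by auto
    ultimately show ?thesis using that by (intro IVT') auto
  qed
  define Z where "Z = {t \<in> {e..b}. g t = 0}"
  have "closed Z" unfolding Z_def
    using e by (intro continuous_closed_preimage_constant continuous_on_subset[OF cont]) auto
  moreover have "bounded Z"
    by (rule bounded_subset[of "{e..b}"]) (auto simp: Z_def)
  ultimately have "compact Z" by (simp add: compact_eq_bounded_closed)
  moreover have "Z \<noteq> {}" using zero[of b] e assms by (auto simp: Z_def)
  ultimately have "\<exists>c\<in>Z. \<forall>t\<in>Z. c \<le> t" by (rule compact_attains_inf)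
  then obtain c where c: "c \<in> Z" "\<And>t. t \<in> Z \<Longrightarrow> c \<le> t" by metis
  have "g t < 0" if t: "a < t" "t < c" for t
  proof (rule ccontr)
    assume nonneg: "\<not> g t < 0"
    with t neg have "d \<le> t" by force
    with t nonneg c e zero[of t] obtain r where "e \<le> r" "r \<le> t" "g r = 0" by (auto simp: Z_def)
    with t c have "r \<in> Z" by (auto simp: Z_def)
    with c \<open>r \<le> t\<close> t show False by force
  qed
  moreover have "a < c" "c \<le> b" "g c = 0" using c e by (auto simp: Z_def)
  ultimately show ?thesis using that by blast
qed

locale node =
  fixes p q a :: real
  assumes p_pos: "0 < p" and q_pos: "0 < q" and distinct: "p \<noteq> q" and a_pos: "0 < a"
begin

definition field :: planar_field where
  "field z = (- (p + q) * fst z - snd z, p * q * fst z - a)"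

text \<open>
  Along solutions the coordinates \<open>q x + y + a / q\<close> and \<open>p x + y + a / p\<close> decay like
  \<open>exp (- q t)\<close> and \<open>exp (- p t)\<close>: they come from the left eigenvectors of the linear part. The
  flow is obtained by solving back for \<open>x\<close> and \<open>y\<close>.
\<close>

definition flow :: "real \<Rightarrow> real \<times> real \<Rightarrow> real \<times> real" where
  "flow t z =
     (let u = (q * fst z + snd z + a / q) * exp (- q * t) - a / q;
          w = (p * fst z + snd z + a / p) * exp (- p * t) - a / p
      in ((w - u) / (p - q), (p * u - q * w) / (p - q)))"

lemma flow_eigen_q:
  "q * fst (flow t z) + snd (flow t z) = (q * fst z + snd z + a / q) * exp (- q * t) - a / q"
proof -
  have *: "q * ((w - u) / (p - q)) + (p * u - q * w) / (p - q) = u" for u w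
    using distinct by (simp add: add_divide_distrib[symmetric] nonzero_divide_eq_eq algebra_simps)
  show ?thesis unfolding flow_def Let_def fst_conv snd_conv by (rule *)
qed

lemma flow_eigen_p:
  "p * fst (flow t z) + snd (flow t z) = (p * fst z + snd z + a / p) * exp (- p * t) - a / p"
proof -
  have *: "p * ((w - u) / (p - q)) + (p * u - q * w) / (p - q) = w" for u w
    using distinct by (simp add: add_divide_distrib[symmetric] nonzero_divide_eq_eq algebra_simps)
  show ?thesis unfolding flow_def Let_def fst_conv snd_conv by (rule *)
qed

lemma eq_by_eigen_coordinates:
  assumes "q * fst z + snd z = q * fst z' + snd z'" "p * fst z + snd z = p * fst z' + snd z'"
  shows "z = z'"
proof -
  have "(p - q) * (fst z - fst z') = 0" using assms by (simp add: algebra_simps)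
  with distinct have "fst z = fst z'" by simp
  with assms show ?thesis by (simp add: prod_eq_iff)
qed

lemma flow_0 [simp]: "flow 0 z = z"
  by (rule eq_by_eigen_coordinates; simp only: flow_eigen_q flow_eigen_p) auto

lemma flow_add: "flow (t + t') z = flow t (flow t' z)"
  by (rule eq_by_eigen_coordinates; simp only: flow_eigen_q flow_eigen_p)
    (simp_all add: exp_add[symmetric] algebra_simps)

lemma flow_has_vector_derivative:
  "((\<lambda>t. flow t z) has_vector_derivative field (flow t z)) (at t within S)"
proof -
  define A B where "A = q * fst z + snd z + a / q" and "B = p * fst z + snd z + a / p"
  define U W where "U t = A * exp (- q * t) - a / q" and "W t = B * exp (- p * t) - a / p" for t
  have eq: "(\<lambda>t. flow t z) = (\<lambda>t. ((W t - U t) / (p - q), (p * U t - q * W t) / (p - q)))"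
    by (simp add: flow_def A_def B_def U_def W_def Let_def)
  have dU: "(U has_real_derivative - q * (A * exp (- q * t))) (at t within S)"
    and dW: "(W has_real_derivative - p * (B * exp (- p * t))) (at t within S)"
    unfolding U_def W_def by (auto intro!: derivative_eq_intros)
  have 1: "((\<lambda>t. (W t - U t) / (p - q)) has_real_derivative
      (- p * (B * exp (- p * t)) - - q * (A * exp (- q * t))) / (p - q)) (at t within S)"
    by (intro DERIV_cdivide DERIV_diff dU dW)
  have 2: "((\<lambda>t. (p * U t - q * W t) / (p - q)) has_real_derivative
      (p * (- q * (A * exp (- q * t))) - q * (- p * (B * exp (- p * t)))) / (p - q))
      (at t within S)"
    by (intro DERIV_cdivide DERIV_diff DERIV_cmult dU dW)
  have eig: "q * fst (flow t z) + snd (flow t z) = A * exp (- q * t) - a / q"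
    "p * fst (flow t z) + snd (flow t z) = B * exp (- p * t) - a / p"
    by (simp_all add: flow_eigen_q flow_eigen_p A_def B_def)
  have cA: "A * exp (- q * t) = q * fst (flow t z) + snd (flow t z) + a / q"
    and cB: "B * exp (- p * t) = p * fst (flow t z) + snd (flow t z) + a / p"
    using eig by simp_all
  have "(- p * (B * exp (- p * t)) - - q * (A * exp (- q * t))) / (p - q)
      = - (p + q) * fst (flow t z) - snd (flow t z)"
    "(p * (- q * (A * exp (- q * t))) - q * (- p * (B * exp (- p * t)))) / (p - q)
      = p * q * fst (flow t z) - a"
    unfolding cA cB using distinct p_pos q_pos
    by (simp_all only: nonzero_divide_eq_eq right_minus_eq not_False_eq_True if_False)
      (simp_all add: field_simps)
  with 1 2 show ?thesis
    unfolding eq field_def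
    by (auto intro!: has_vector_derivative_Pair simp: has_real_derivative_iff_has_vector_derivative)
qed

lemma continuous_on_flow [continuous_intros]:
  assumes "continuous_on S f" "continuous_on S g"
  shows "continuous_on S (\<lambda>v. flow (f v) (g v))"
  unfolding flow_def Let_def using assms distinct p_pos q_pos by (intro continuous_intros) auto

text \<open>
  Uniqueness of solutions: in the eigen-coordinates, multiplied by the growing exponentials, every
  solution is constant.
\<close>

lemma solution_eq_flow:
  assumes cont: "continuous_on {b..c} \<gamma>"
    and ode: "\<And>t. b < t \<Longrightarrow> t < c \<Longrightarrow> (\<gamma> has_vector_derivative field (\<gamma> t)) (at t)"
    and t: "t \<in> {b..c}"
  shows "\<gamma> t = flow (t - b) (\<gamma> b)"
proof (cases "t = b")
  case False
  with t have bt: "b < t" by simp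
  define x y where "x = (\<lambda>t. fst (\<gamma> t))" and "y = (\<lambda>t. snd (\<gamma> t))"
  have dx: "(x has_real_derivative - (p + q) * x r - y r) (at r)"
    and dy: "(y has_real_derivative p * q * x r - a) (at r)" if "b < r" "r < c" for r
    using has_derivative_fst[OF ode[OF that, unfolded has_vector_derivative_def]]
      has_derivative_snd[OF ode[OF that, unfolded has_vector_derivative_def]]
    by (simp_all add: x_def y_def field_def has_real_derivative_iff_has_vector_derivative
        has_vector_derivative_def)
  have conts: "continuous_on {b..t} x" "continuous_on {b..t} y"
    unfolding x_def y_def using t
    by (auto intro!: continuous_intros continuous_on_subset[OF cont])
  have const: "(m * x t + y t + a / m) * exp (m * t) = (m * x b + y b + a / m) * exp (m * b)"
    if m: "m > 0" and mroot: "p + q - m = p * q / m" for m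
  proof (rule DERIV_isconst_end[OF bt])
    show "continuous_on {b..t} (\<lambda>r. (m * x r + y r + a / m) * exp (m * r))"
      using conts m by (intro continuous_intros) auto
    fix r assume r: "b < r" "r < t"
    have pq: "p * q = (p + q - m) * m" using m mroot by simp
    have "((\<lambda>r. (m * x r + y r + a / m) * exp (m * r)) has_real_derivative
        (m * (- (p + q) * x r - y r) + (p * q * x r - a)) * exp (m * r)
        + (m * x r + y r + a / m) * (m * exp (m * r))) (at r)"
      using dx[of r] dy[of r] r t by (auto intro!: derivative_eq_intros)
    moreover have "(m * (- (p + q) * x r - y r) + (p * q * x r - a)) * exp (m * r)
        + (m * x r + y r + a / m) * (m * exp (m * r)) = 0"
      unfolding pq using m by (simp add: field_simps)
    ultimately show "((\<lambda>r. (m * x r + y r + a / m) * exp (m * r)) has_real_derivative 0) (at r)"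
      by simp
  qed
  have eig: "m * x t + y t = (m * x b + y b + a / m) * exp (- m * (t - b)) - a / m"
    if m: "m > 0" and mroot: "p + q - m = p * q / m" for m
  proof -
    have "m * x t + y t + a / m = (m * x t + y t + a / m) * exp (m * t) * exp (- m * t)"
      by (simp add: exp_minus)
    also have "\<dots> = (m * x b + y b + a / m) * (exp (m * b) * exp (- m * t))"
      using const[OF that] by simp
    also have "exp (m * b) * exp (- m * t) = exp (- m * (t - b))"
      by (simp add: exp_add[symmetric] algebra_simps)
    finally show ?thesis by simp
  qed
  show ?thesis
  proof (rule eq_by_eigen_coordinates)
    show "q * fst (\<gamma> t) + snd (\<gamma> t)
        = q * fst (flow (t - b) (\<gamma> b)) + snd (flow (t - b) (\<gamma> b))"
      using eig[of q] q_pos by (simp add: flow_eigen_q x_def y_def)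
    show "p * fst (\<gamma> t) + snd (\<gamma> t)
        = p * fst (flow (t - b) (\<gamma> b)) + snd (flow (t - b) (\<gamma> b))"
      using eig[of p] p_pos by (simp add: flow_eigen_p x_def y_def)
  qed
qed simp

text \<open>
  \<open>h\<close> solves the homogeneous equation \<open>x'' + (p + q) x' + p q x = 0\<close> with \<open>x 0 = 0\<close> and
  \<open>x' 0 = 1\<close>, and \<open>H\<close> is its primitive; they express the first coordinate of the flow on the
  line \<open>x = 0\<close>.
\<close>

definition h :: "real \<Rightarrow> real" where
  "h t = (exp (- q * t) - exp (- p * t)) / (p - q)"

definition H :: "real \<Rightarrow> real" where
  "H t = ((1 - exp (- q * t)) / q - (1 - exp (- p * t)) / p) / (p - q)"

lemma fst_flow_axis: "fst (flow t (0, y)) = a * H t - y * h t"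
proof -
  have "(y + a / p) * F - a / p - ((y + a / q) * E - a / q)
      = a * ((1 - E) / q - (1 - F) / p) - y * (E - F)" for E F
    using p_pos q_pos by (simp add: field_simps)
  then show ?thesis
    by (simp add: flow_def h_def H_def Let_def diff_divide_distrib[symmetric])
qed

lemma h_pos: "0 < t \<Longrightarrow> 0 < h t"
  unfolding h_def zero_less_divide_iff using distinct
  by (cases "p < q") auto

text \<open>
  Time reversal multiplies \<open>h\<close> by a growing factor; this is where the negative divergence
  \<open>- (p + q)\<close> enters, and the two comparisons of \<open>H t\<close> with \<open>H (- t)\<close> below rest on it.
\<close>

lemma h_reflect: "h (- t) = - exp ((p + q) * t) * h t"
  by (simp add: h_def field_simps exp_add[symmetric] minus_divide_left)

lemma h_neg: "t < 0 \<Longrightarrow> h t < 0"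
  using h_reflect[of "- t"] h_pos[of "- t"] by (simp add: mult_pos_pos)

lemma h_nonzero: "t \<noteq> 0 \<Longrightarrow> h t \<noteq> 0"
  using h_pos[of t] h_neg[of t] by linarith

lemma H_0 [simp]: "H 0 = 0" by (simp add: H_def)

lemma H_has_derivative [derivative_intros]:
  "(H has_real_derivative h t) (at t within S)"
  unfolding H_def h_def using p_pos q_pos
  by (intro DERIV_cdivide) (auto intro!: derivative_eq_intros)

lemma H_pos:
  assumes "t \<noteq> 0" shows "0 < H t"
proof (cases "0 < t")
  case True
  have "H 0 < H t"
    by (rule DERIV_pos_imp_increasing_open[OF True])
      (auto intro: H_has_derivative h_pos intro!: DERIV_continuous_on[OF H_has_derivative])
  then show ?thesis by simp
next
  case False
  with assms have "t < 0" by simp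
  have "H t > H 0"
    by (rule DERIV_neg_imp_decreasing_open[OF \<open>t < 0\<close>])
      (auto intro: H_has_derivative h_neg intro!: DERIV_continuous_on[OF H_has_derivative])
  then show ?thesis by simp
qed

lemma H_less_H_minus:
  assumes "0 < t" shows "H t < H (- t)"
proof -
  have "(\<lambda>t. H (- t) - H t) 0 < (\<lambda>t. H (- t) - H t) t"
  proof (rule DERIV_pos_imp_increasing_open[OF assms])
    fix r :: real assume r: "0 < r"
    have "((\<lambda>t. H (- t) - H t) has_real_derivative (exp ((p + q) * r) - 1) * h r) (at r)"
      by (auto intro!: derivative_eq_intros DERIV_chain2[of H, OF H_has_derivative]
          simp: h_reflect algebra_simps)
    moreover have "0 < (exp ((p + q) * r) - 1) * h r"
      using r p_pos q_pos h_pos[OF r] by (intro mult_pos_pos) auto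
    ultimately show "\<exists>d. ((\<lambda>t. H (- t) - H t) has_real_derivative d) (at r) \<and> 0 < d" by blast
  qed (auto intro!: continuous_intros continuous_on_compose2[of UNIV H]
      DERIV_continuous_on[OF H_has_derivative])
  then show ?thesis by simp
qed

lemma H_minus_less:
  assumes "0 < t" shows "exp (- (p + q) * t) * H (- t) < H t"
proof -
  let ?M = "\<lambda>t. H t - exp (- (p + q) * t) * H (- t)"
  have "?M 0 < ?M t"
  proof (rule DERIV_pos_imp_increasing_open[OF assms])
    fix r :: real assume r: "0 < r"
    have e: "exp (- ((p + q) * r)) * h (- r) = - h r"
      by (simp add: h_reflect exp_minus)
    have "(?M has_real_derivative
        h r - (exp (- (p + q) * r) * (- (p + q)) * H (- r) + exp (- (p + q) * r) * - h (- r))) (at r)"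
      by (auto intro!: derivative_eq_intros DERIV_chain2[of H, OF H_has_derivative]
          simp: algebra_simps)
    then have "(?M has_real_derivative (p + q) * exp (- (p + q) * r) * H (- r)) (at r)"
      using e by (simp add: algebra_simps)
    moreover have "0 < (p + q) * exp (- (p + q) * r) * H (- r)"
      using r p_pos q_pos H_pos[of "- r"] by auto
    ultimately show "\<exists>d. (?M has_real_derivative d) (at r) \<and> 0 < d" by blast
  qed (auto intro!: continuous_intros continuous_on_compose2[of UNIV H]
      DERIV_continuous_on[OF H_has_derivative])
  then show ?thesis by simp
qed

text \<open>
  The arc that leaves the line \<open>x = 0\<close> and returns to it after time \<open>t\<close> starts at \<open>y = height t\<close>
  (for \<open>t > 0\<close>) and, running it backwards, ends at \<open>y = height (- t)\<close>. Parametrising arcs by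
  their duration makes both ends explicit although the half return map itself is not.
\<close>

definition height :: "real \<Rightarrow> real" where
  "height t = a * H t / h t"

lemma fst_flow_axis_eq_0_iff:
  assumes "t \<noteq> 0" shows "fst (flow t (0, y)) = 0 \<longleftrightarrow> y = height t"
  using h_nonzero[OF assms] by (auto simp: fst_flow_axis height_def field_simps)

lemma fst_flow_axis_neg_iff:
  assumes "0 < t" shows "fst (flow t (0, y)) < 0 \<longleftrightarrow> height t < y"
  using h_pos[OF assms] by (simp add: fst_flow_axis height_def field_simps)

lemma height_pos: "0 < t \<Longrightarrow> 0 < height t"
  by (simp add: height_def h_pos H_pos a_pos)

lemma height_minus: "height (- t) = - (exp (- (p + q) * t) * (a * H (- t)) / h t)"
proof -
  have "exp (- (p + q) * t) = inverse (exp ((p + q) * t))"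
    by (simp only: mult_minus_left exp_minus)
  then show ?thesis by (simp add: height_def h_reflect divide_simps)
qed

lemma height_neg: "t < 0 \<Longrightarrow> height t < 0"
  by (simp add: height_def h_neg H_pos a_pos divide_pos_neg)

text \<open>
  The identity \<open>h\<^sup>2 - H h' = exp (- (p + q) t) H (- t)\<close> expresses the slope at one end of an arc by
  the height of its other end.
\<close>

lemma height_has_derivative:
  assumes "t \<noteq> 0"
  shows "(height has_real_derivative - height (- t) / h t) (at t)"
proof -
  define k where "k = (p * exp (- p * t) - q * exp (- q * t)) / (p - q)"
  have dh: "(h has_real_derivative k) (at t)"
    unfolding h_def k_def using distinct
    by (auto intro!: derivative_eq_intros DERIV_cdivide)
  have "(height has_real_derivative (a * h t * h t - a * H t * k) / (h t * h t)) (at t)"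
    unfolding height_def using h_nonzero[OF assms]
    by (auto intro!: derivative_eq_intros dh simp: field_simps)
  moreover have "h t * h t - H t * k = exp (- (p + q) * t) * H (- t)"
  proof -
    define E F where "E = exp (- q * t)" and "F = exp (- p * t)"
    have E: "exp (q * t) = 1 / E" and F: "exp (p * t) = 1 / F"
      by (simp_all add: E_def F_def exp_minus field_simps)
    have EF: "exp (- (p + q) * t) = E * F"
      by (simp add: E_def F_def exp_add[symmetric] algebra_simps)
    have pos: "E > 0" "F > 0" by (simp_all add: E_def F_def)
    have "h t = (E - F) / (p - q)" "H t = ((1 - E) / q - (1 - F) / p) / (p - q)"
      "k = (p * F - q * E) / (p - q)"
      by (simp_all add: h_def H_def k_def E_def F_def)
    moreover have "E * F * H (- t) = ((E * F - F) / q - (E * F - E) / p) / (p - q)"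
      using pos distinct p_pos q_pos by (simp add: H_def E F field_simps)
    moreover have "(E - F) / d * ((E - F) / d) - ((1 - E) / q - (1 - F) / p) / d * ((p * F - q * E) / d)
        = ((E * F - F) / q - (E * F - E) / p) / d" if "d = p - q" "d \<noteq> 0" for d
    proof -
      have "(E - F) * (E - F) - ((1 - E) / q - (1 - F) / p) * (p * F - q * E)
        = ((E * F - F) / q - (E * F - E) / p) * d"
        unfolding that(1) using p_pos q_pos by (simp add: field_simps)
      moreover have "x / d * (x / d) - A / d * (B / d) = C / d"
        if "x * x - A * B = C * d" for x A B C :: real
        using that \<open>d \<noteq> 0\<close> by (simp add: diff_divide_distrib[symmetric])
      ultimately show ?thesis by blast
    qed
    ultimately show ?thesis using distinct unfolding EF by simp
  qed
  ultimately have "(height has_real_derivative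
      a * (exp (- (p + q) * t) * H (- t)) / (h t * h t)) (at t)"
    by (metis (no_types, lifting) mult.assoc right_diff_distrib)
  moreover have "- height (- t) / h t = a * (exp (- (p + q) * t) * H (- t)) / (h t * h t)"
    by (simp add: height_minus field_simps)
  ultimately show ?thesis by simp
qed

lemma continuous_on_height: "0 \<notin> S \<Longrightarrow> continuous_on S height"
  by (metis DERIV_isCont continuous_at_imp_continuous_on height_has_derivative)

lemma height_strict_mono:
  assumes "0 < t" "t < t'" shows "height t < height t'"
proof (rule DERIV_pos_imp_increasing_open[OF assms(2)])
  fix r assume "t < r" with assms have "0 < r" by simp
  then show "\<exists>d. (height has_real_derivative d) (at r) \<and> 0 < d"
    using height_has_derivative[of r] h_pos[of r] height_neg[of "- r"]
    by (intro exI[of _ "- height (- r) / h r"]) (auto simp: divide_neg_pos)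
qed (use assms in \<open>auto intro!: continuous_on_height\<close>)

lemma height_less_iff: "0 < t \<Longrightarrow> 0 < t' \<Longrightarrow> height t < height t' \<longleftrightarrow> t < t'"
  by (metis height_strict_mono linorder_less_linear order_less_asym)

lemma height_eq_iff: "0 < t \<Longrightarrow> 0 < t' \<Longrightarrow> height t = height t' \<longleftrightarrow> t = t'"
  by (metis height_less_iff linorder_less_linear order_less_irrefl)

lemma height_minus_strict_antimono:
  assumes "0 < t" "t < t'" shows "height (- t') < height (- t)"
proof -
  have less: "- t' < - t" using assms by simp
  show ?thesis
  proof (rule DERIV_pos_imp_increasing_open[OF less])
    fix r assume "r < - t" with assms have "r < 0" by simp
    then show "\<exists>d. (height has_real_derivative d) (at r) \<and> 0 < d"
      using height_has_derivative[of r] h_neg[of r] height_pos[of "- r"]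
      by (intro exI[of _ "- height (- r) / h r"]) (auto simp: divide_pos_neg)
  qed (use assms in \<open>auto intro!: continuous_on_height\<close>)
qed

lemma minus_height_minus_less:
  assumes "0 < t" shows "- height (- t) < height t"
proof -
  have "a * (exp (- (p + q) * t) * H (- t)) < a * H t"
    using H_minus_less[OF assms] a_pos by (intro mult_strict_left_mono)
  then show ?thesis
    using h_pos[OF assms] unfolding height_minus minus_minus unfolding height_def
    by (intro divide_strict_right_mono) (simp_all add: mult.left_commute)
qed

text \<open>
  The sum of the two end heights increases with the duration: by the formula for the
  slopes, its derivative has the sign of \<open>H (- t) - H t\<close>.
\<close>

lemma height_contracts:
  assumes "0 < t" "t < t'"
  shows "height (- t) - height (- t') < height t' - height t"
proof -
  let ?g = "\<lambda>t. height t + height (- t)"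
  have "?g t < ?g t'"
  proof (rule DERIV_pos_imp_increasing_open[OF assms(2)])
    fix r assume "t < r" with assms have r: "0 < r" by simp
    have d: "(?g has_real_derivative - height (- r) / h r + - (- height r / h (- r))) (at r)"
      using r DERIV_chain2[of height "- height r / h (- r)" uminus r "-1" UNIV,
          OF _ DERIV_minus[OF DERIV_ident]]
        height_has_derivative[of r] height_has_derivative[of "- r"]
      by (auto intro!: DERIV_add derivative_eq_intros)
    have "h r * (- height (- r) / h r + - (- height r / h (- r)))
        = exp (- (p + q) * r) * a * (H (- r) - H r) / h r"
    proof -
      have "exp (- (p + q) * r) = inverse (exp ((p + q) * r))"
        by (simp only: mult_minus_left exp_minus)
      then show ?thesis
        using h_pos[OF r] unfolding h_reflect height_minus unfolding height_def
        by (simp add: divide_simps) (simp add: algebra_simps)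
    qed
    also have "\<dots> > 0"
      using H_less_H_minus[OF r] h_pos[OF r] a_pos by auto
    finally have "- height (- r) / h r + - (- height r / h (- r)) > 0"
      using h_pos[OF r] zero_less_mult_pos by blast
    with d show "\<exists>d. (?g has_real_derivative d) (at r) \<and> 0 < d" by blast
  next
    show "continuous_on {t..t'} ?g"
      using assms
      by (intro continuous_intros continuous_on_height continuous_on_compose2[of "{..<0}" height]) auto
  qed
  then show ?thesis by simp
qed

lemma fst_flow_has_derivative:
  "((\<lambda>t. fst (flow t z)) has_real_derivative
     - (p + q) * fst (flow t z) - snd (flow t z)) (at t within S)"
  using has_derivative_fst[OF flow_has_vector_derivative[unfolded has_vector_derivative_def]]
  by (simp add: field_def has_real_derivative_iff_has_vector_derivative has_vector_derivative_def)

lemma snd_flow_has_derivative: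
  "((\<lambda>t. snd (flow t z)) has_real_derivative p * q * fst (flow t z) - a) (at t within S)"
  using has_derivative_snd[OF flow_has_vector_derivative[unfolded has_vector_derivative_def]]
  by (simp add: field_def has_real_derivative_iff_has_vector_derivative has_vector_derivative_def)

text \<open>
  The equilibrium \<open>a / (p q)\<close> of the first coordinate is positive, so the node is virtual
  for the half-plane \<open>x < 0\<close>.
\<close>

lemma flow_leaves: "\<exists>t>0. 0 < fst (flow t z)"
proof -
  have decay: "((\<lambda>t. exp (- m * t)) \<longlongrightarrow> 0) at_top" if "m > 0" for m :: real
    using that by (intro filterlim_compose[OF exp_at_bot]
        filterlim_tendsto_neg_mult_at_bot[OF tendsto_const]) (auto intro: filterlim_ident)
  have "((\<lambda>t. fst (flow t z)) \<longlongrightarrow>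
      (((p * fst z + snd z + a / p) * 0 - a / p) - ((q * fst z + snd z + a / q) * 0 - a / q))
        / (p - q)) at_top"
    unfolding flow_def Let_def fst_conv using distinct
    by (intro tendsto_intros decay p_pos q_pos) auto
  moreover have "(((p * fst z + snd z + a / p) * 0 - a / p)
      - ((q * fst z + snd z + a / q) * 0 - a / q)) / (p - q) = a / (p * q)"
    using distinct p_pos q_pos
    by (simp only: nonzero_divide_eq_eq right_minus_eq not_False_eq_True if_False)
      (simp add: field_simps)
  moreover have "a / (p * q) > 0" using a_pos p_pos q_pos by simp
  ultimately have "eventually (\<lambda>t. 0 < fst (flow t z)) at_top"
    by (simp only: order_tendstoD(1))
  then obtain b where "\<And>t. t \<ge> b \<Longrightarrow> 0 < fst (flow t z)"
    by (auto simp: eventually_at_top_linorder)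
  then have "0 < fst (flow (max b 1) z)" by simp
  then show ?thesis by (meson less_max_iff_disj zero_less_one)
qed

definition entering :: "real \<times> real \<Rightarrow> bool" where
  "entering z \<longleftrightarrow> fst z < 0 \<or> fst z = 0 \<and> 0 < snd z"

lemma entering_moves_left:
  assumes "entering z" obtains d where "0 < d" "\<And>t. 0 < t \<Longrightarrow> t < d \<Longrightarrow> fst (flow t z) < 0"
proof (cases "fst z < 0")
  case True
  have "isCont (\<lambda>t. fst (flow t z)) 0"
    using fst_flow_has_derivative DERIV_isCont by blast
  then have "((\<lambda>t. fst (flow t z)) \<longlongrightarrow> fst z) (at_right 0)"
    by (simp add: isCont_def filterlim_at_split)
  then have "eventually (\<lambda>t. fst (flow t z) < 0) (at_right 0)"
    using True by (rule order_tendstoD)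
  with that show ?thesis by (auto simp: eventually_at_right_field)
next
  case False
  with assms have z: "fst z = 0" "0 < snd z" by (auto simp: entering_def)
  have "((\<lambda>t. fst (flow t z)) has_real_derivative - snd z) (at 0)"
    using fst_flow_has_derivative[of z 0 UNIV] z by simp
  from DERIV_neg_dec_right[OF this] z that show ?thesis by auto
qed

text \<open>
  At the return time the arc cannot touch the line from the left with \<open>y \<ge> 0\<close>: backwards
  from \<open>(0, y)\<close> the first coordinate is \<open>a H (- r) - y h (- r) > 0\<close>.
\<close>

lemma first_return:
  assumes "entering z"
  obtains \<tau> where "0 < \<tau>" "fst (flow \<tau> z) = 0" "snd (flow \<tau> z) < 0"
    "\<And>t. 0 < t \<Longrightarrow> t < \<tau> \<Longrightarrow> fst (flow t z) < 0"
proof -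
  obtain d where d: "0 < d" "\<And>t. 0 < t \<Longrightarrow> t < d \<Longrightarrow> fst (flow t z) < 0"
    using entering_moves_left[OF assms] by blast
  obtain b where b: "0 < b" "0 < fst (flow b z)" using flow_leaves by blast
  have "continuous_on {0..b} (\<lambda>t. fst (flow t z))" by (intro continuous_intros)
  from first_zero[OF d this b(1) less_imp_le[OF b(2)]]
  obtain \<tau> where \<tau>0: "0 < \<tau>" "fst (flow \<tau> z) = 0"
    and neg: "\<And>t. 0 < t \<Longrightarrow> t < \<tau> \<Longrightarrow> fst (flow t z) < 0" by blast
  have "snd (flow \<tau> z) < 0"
  proof (rule ccontr)
    assume "\<not> snd (flow \<tau> z) < 0"
    then have y: "0 \<le> snd (flow \<tau> z)" by simp
    define r where "r = \<tau> / 2"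
    have r: "0 < r" "r < \<tau>" using \<tau>0 by (auto simp: r_def)
    have "flow (\<tau> - r) z = flow (- r) (0, snd (flow \<tau> z))"
      using flow_add[of "- r" \<tau> z] \<tau>0 prod.collapse[of "flow \<tau> z"] by simp
    then have "fst (flow (\<tau> - r) z) = a * H (- r) - snd (flow \<tau> z) * h (- r)"
      by (simp add: fst_flow_axis)
    moreover have "0 < a * H (- r)" using r a_pos H_pos[of "- r"] by simp
    moreover have "snd (flow \<tau> z) * h (- r) \<le> 0"
      using y h_neg[of "- r"] r by (simp add: mult_nonneg_nonpos)
    ultimately have "0 < fst (flow (\<tau> - r) z)" by linarith
    with neg[of "\<tau> - r"] r show False by simp
  qed
  with that \<tau>0 neg show ?thesis by blast
qed

lemma snd_flow_decreasing:
  assumes "\<And>t. 0 < t \<Longrightarrow> t < \<tau> \<Longrightarrow> fst (flow t z) < 0" "0 \<le> t" "t < t'" "t' \<le> \<tau>"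
  shows "snd (flow t' z) < snd (flow t z)"
proof (rule DERIV_neg_imp_decreasing_open[OF assms(3)])
  fix r assume r: "t < r" "r < t'"
  with assms have "fst (flow r z) < 0" by auto
  then have "p * q * fst (flow r z) < 0" using p_pos q_pos by (simp add: mult_pos_neg)
  then show "\<exists>d. ((\<lambda>t. snd (flow t z)) has_real_derivative d) (at r) \<and> d < 0"
    using snd_flow_has_derivative[of z r UNIV] a_pos
    by (intro exI[of _ "p * q * fst (flow r z) - a"]) auto
qed (intro continuous_intros)

text \<open>
  The arc from \<open>(0, y)\<close> lasts \<open>flight y\<close> and lands at \<open>(0, - transit y)\<close>; with this sign the half
  return map sends the positive half-line into itself.
\<close>

definition flight :: "real \<Rightarrow> real" where
  "flight y = (THE t. 0 < t \<and> height t = y)"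

definition transit :: "real \<Rightarrow> real" where
  "transit y = - height (- flight y)"

lemma flight_height: "0 < t \<Longrightarrow> flight (height t) = t"
  unfolding flight_def by (rule the_equality) (auto simp: height_eq_iff)

lemma height_onto:
  assumes "0 < y" obtains t where "0 < t" "height t = y"
proof -
  have "entering (0, y)" using assms by (simp add: entering_def)
  then obtain \<tau> where "0 < \<tau>" "fst (flow \<tau> (0, y)) = 0" by (rule first_return)
  with that show ?thesis by (auto simp: fst_flow_axis_eq_0_iff)
qed

lemma flight_pos: "0 < y \<Longrightarrow> 0 < flight y"
  using height_onto[of y] flight_height by metis

lemma height_flight: "0 < y \<Longrightarrow> height (flight y) = y"
  using height_onto[of y] flight_height by metis

lemma flight_less_iff: "0 < y \<Longrightarrow> 0 < y' \<Longrightarrow> flight y < flight y' \<longleftrightarrow> y < y'"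
  using height_less_iff[of "flight y" "flight y'"] by (simp add: flight_pos height_flight)

lemma fst_flow_before_flight: "0 < y \<Longrightarrow> 0 < t \<Longrightarrow> t < flight y \<Longrightarrow> fst (flow t (0, y)) < 0"
  by (metis fst_flow_axis_neg_iff height_flight height_strict_mono)

lemma flow_flight:
  assumes "0 < y" shows "flow (flight y) (0, y) = (0, - transit y)"
proof -
  let ?t = "flight y"
  have t: "0 < ?t" "height ?t = y" using assms flight_pos height_flight by auto
  have x: "fst (flow ?t (0, y)) = 0" using t by (simp add: fst_flow_axis_eq_0_iff)
  then have "flow (- ?t) (0, snd (flow ?t (0, y))) = (0, y)"
    using flow_add[of "- ?t" ?t "(0, y)"] prod.collapse[of "flow ?t (0, y)"] by simp
  then have "snd (flow ?t (0, y)) = height (- ?t)"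
    using fst_flow_axis_eq_0_iff[of "- ?t" "snd (flow ?t (0, y))"] t by simp
  with x show ?thesis by (simp add: transit_def prod_eq_iff)
qed

lemma transit_pos: "0 < y \<Longrightarrow> 0 < transit y"
  using height_neg[of "- flight y"] flight_pos[of y] by (simp add: transit_def)

lemma transit_less: "0 < y \<Longrightarrow> transit y < y"
  using minus_height_minus_less[of "flight y"] flight_pos[of y] height_flight[of y]
  by (simp add: transit_def)

lemma transit_strict_mono:
  assumes "0 < y" "y < y'" shows "transit y < transit y'"
  using height_minus_strict_antimono[of "flight y" "flight y'"] assms flight_pos flight_less_iff
  by (simp add: transit_def)

lemma transit_contracts:
  assumes "0 < y" "y < y'" shows "transit y' - transit y < y' - y"
  using height_contracts[of "flight y" "flight y'"] assms flight_pos flight_less_iff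
  by (simp add: transit_def height_flight)

text \<open>
  Landing points lie above the invariant line \<open>q x + y + a / q = 0\<close>, which meets \<open>x = 0\<close> at
  \<open>y = - a / q\<close>.
\<close>

lemma transit_bounded:
  assumes "0 < y" shows "transit y < a / q"
proof -
  have "- transit y = (y + a / q) * exp (- q * flight y) - a / q"
    using flow_eigen_q[of "flight y" "(0, y)"] flow_flight[OF assms] by simp
  moreover have "0 < (y + a / q) * exp (- q * flight y)"
    using assms a_pos q_pos by (simp add: add_pos_pos)
  ultimately show ?thesis by linarith
qed

lemma continuous_on_flight: "continuous_on {0<..} flight"
proof (rule continuous_onI_mono)
  have "flight ` {0<..} = {0<..}"
    using flight_pos flight_height height_pos by (force simp: image_iff)
  then show "open (flight ` {0<..})" by simp
  fix x y assume "x \<in> {0<..}" "y \<in> {0<..}" "x \<le> (y::real)"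
  then show "flight x \<le> flight y" using flight_less_iff[of y x] by force
qed

text \<open>
  After rescaling time to \<open>{0..1}\<close>, arcs depend uniformly continuously on their starting height
  near any given one.
\<close>

lemma arcs_close:
  assumes "0 < y\<^sub>0" "0 < e"
  obtains d where "0 < d"
    "\<And>y t. \<bar>y - y\<^sub>0\<bar> < d \<Longrightarrow> t \<in> {0..flight y} \<Longrightarrow>
       \<exists>t'\<in>{0..flight y\<^sub>0}. dist (flow t (0, y)) (flow t' (0, y\<^sub>0)) < e"
proof -
  define K where "K = {y\<^sub>0 / 2..2 * y\<^sub>0} \<times> {0..1::real}"
  define F where "F = (\<lambda>(y, l). flow (l * flight y) (0, y))"
  have "continuous_on K F"
    unfolding F_def K_def case_prod_unfold using assms
    by (intro continuous_intros continuous_on_compose2[OF continuous_on_flight]) auto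
  moreover have "compact K" unfolding K_def by (intro compact_Times) auto
  ultimately have "uniformly_continuous_on K F" by (rule compact_uniformly_continuous)
  then obtain d where d: "d > 0"
    "\<And>v v'. v \<in> K \<Longrightarrow> v' \<in> K \<Longrightarrow> dist v' v < d \<Longrightarrow> dist (F v') (F v) < e"
    using assms unfolding uniformly_continuous_on_def by metis
  show ?thesis
  proof
    show "0 < min d (y\<^sub>0 / 2)" using d assms by simp
    fix y t assume y: "\<bar>y - y\<^sub>0\<bar> < min d (y\<^sub>0 / 2)" and t: "t \<in> {0..flight y}"
    then have ypos: "0 < y" and yK: "y \<in> {y\<^sub>0 / 2..2 * y\<^sub>0}" by (auto simp: abs_if split: if_splits)
    define l where "l = t / flight y"
    have l: "l \<in> {0..1}" "l * flight y = t"
      using t flight_pos[OF ypos] by (auto simp: l_def)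
    have "dist (F (y, l)) (F (y\<^sub>0, l)) < e"
      using y yK l assms by (intro d) (auto simp: K_def dist_Pair_Pair dist_real_def)
    moreover have "l * flight y\<^sub>0 \<in> {0..flight y\<^sub>0}"
      using l flight_pos[OF assms(1)] by (auto simp: mult_left_le_one_le)
    ultimately show "\<exists>t'\<in>{0..flight y\<^sub>0}. dist (flow t (0, y)) (flow t' (0, y\<^sub>0)) < e"
      using l by (auto simp: F_def)
  qed
qed

end

section \<open>Gluing crossing solutions\<close>

lemma crossing_solutionD:
  assumes "crossing_solution X Y I \<gamma>"
  shows "continuous_on I \<gamma>"
    and "\<And>t. t \<in> I \<Longrightarrow> fst (\<gamma> t) < 0 \<Longrightarrow> (\<gamma> has_vector_derivative X (\<gamma> t)) (at t within I)"
    and "\<And>t. t \<in> I \<Longrightarrow> 0 < fst (\<gamma> t) \<Longrightarrow> (\<gamma> has_vector_derivative Y (\<gamma> t)) (at t within I)"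
    and "\<And>t. t \<in> I \<Longrightarrow> \<gamma> t \<in> switching_line \<Longrightarrow> \<gamma> t \<in> crossing_points X Y"
    and "\<And>a b. {a..b} \<subseteq> I \<Longrightarrow> finite {t \<in> {a..b}. \<gamma> t \<in> switching_line}"
  using assms unfolding crossing_solution_def by blast+

lemma crossing_solution_shift:
  assumes sol: "crossing_solution X Y I \<gamma>" and sub: "\<And>t. t \<in> J \<Longrightarrow> t - c \<in> I"
  shows "crossing_solution X Y J (\<lambda>t. \<gamma> (t - c))"
proof -
  have img: "(\<lambda>t. t - c) ` J \<subseteq> I" using sub by auto
  have deriv: "((\<lambda>t. \<gamma> (t - c)) has_vector_derivative v) (at t within J)"
    if "(\<gamma> has_vector_derivative v) (at (t - c) within I)" for t v
  proof -
    have "((\<lambda>t. t - c) has_vector_derivative 1) (at t within J)"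
      by (auto intro!: derivative_eq_intros)
    from vector_diff_chain_within[OF this has_vector_derivative_within_subset[OF that img]]
    show ?thesis by (simp add: o_def)
  qed
  have "finite {t \<in> {a..b}. \<gamma> (t - c) \<in> switching_line}" if ab: "{a..b} \<subseteq> J" for a b
  proof -
    have "{a - c..b - c} \<subseteq> I"
    proof
      fix r assume "r \<in> {a - c..b - c}"
      then have "r + c \<in> J" using ab by auto
      then show "r \<in> I" using sub[of "r + c"] by simp
    qed
    then have "finite ((+) c ` {t \<in> {a - c..b - c}. \<gamma> t \<in> switching_line})"
      using sol unfolding crossing_solution_def by blast
    moreover have "{t \<in> {a..b}. \<gamma> (t - c) \<in> switching_line}
        \<subseteq> (+) c ` {t \<in> {a - c..b - c}. \<gamma> t \<in> switching_line}"
      by (auto intro!: image_eqI[of _ "(+) c" "t - c" for t])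
    ultimately show ?thesis by (rule finite_subset[rotated])
  qed
  moreover have "continuous_on J (\<lambda>t. \<gamma> (t - c))"
    using sol sub unfolding crossing_solution_def
    by (auto intro!: continuous_on_compose2[of I \<gamma>] continuous_intros)
  ultimately show ?thesis
    using sol sub deriv unfolding crossing_solution_def by blast
qed

lemma crossing_solution_subset:
  assumes "crossing_solution X Y I \<gamma>" "J \<subseteq> I" shows "crossing_solution X Y J \<gamma>"
  using crossing_solution_shift[OF assms(1), of J 0] assms(2) by auto

lemma crossing_solution_cong:
  assumes sol: "crossing_solution X Y I \<gamma>" and eq: "\<And>t. t \<in> I \<Longrightarrow> \<gamma> t = \<gamma>' t"
  shows "crossing_solution X Y I \<gamma>'"
proof -
  have deriv: "(\<gamma>' has_vector_derivative v) (at t within I)"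
    if "t \<in> I" "(\<gamma> has_vector_derivative v) (at t within I)" for t v
    by (rule has_vector_derivative_transform[OF that(1) _ that(2)]) (simp add: eq)
  have "finite {t \<in> {a..b}. \<gamma>' t \<in> switching_line}" if ab: "{a..b} \<subseteq> I" for a b
  proof -
    have "{t \<in> {a..b}. \<gamma>' t \<in> switching_line} = {t \<in> {a..b}. \<gamma> t \<in> switching_line}"
    proof (intro Collect_cong conj_cong refl)
      fix t assume "t \<in> {a..b}"
      with ab have "t \<in> I" by blast
      then show "\<gamma>' t \<in> switching_line \<longleftrightarrow> \<gamma> t \<in> switching_line" by (simp add: eq)
    qed
    then show ?thesis using sol ab unfolding crossing_solution_def by simp
  qed
  moreover have "continuous_on I \<gamma>'"
    using sol continuous_on_cong[OF refl eq, of I] unfolding crossing_solution_def by simp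
  ultimately show ?thesis
    using sol deriv unfolding crossing_solution_def by (simp add: eq)
qed

text \<open>
  Gluing at a time when the curve is on the switching line needs no agreement of derivatives.
\<close>

lemma crossing_solution_glue:
  assumes I: "crossing_solution X Y {a..b} \<gamma>" and J: "crossing_solution X Y {b..c} \<gamma>"
    and b: "\<gamma> b \<in> switching_line" and le: "a \<le> b" "b \<le> c"
  shows "crossing_solution X Y {a..c} \<gamma>"
proof -
  have un: "{a..c} = {a..b} \<union> {b..c}" using le by auto
  have left: "(\<gamma> has_vector_derivative v) (at t within {a..c})"
    if "(\<gamma> has_vector_derivative v) (at t within {a..b})" "t < b" for t v
  proof -
    have "at t within {a..c} = at t within {a..b}"
      by (rule at_within_nhd[of _ "{..<b}"]) (use that le in auto)
    with that show ?thesis by simp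
  qed
  have right: "(\<gamma> has_vector_derivative v) (at t within {a..c})"
    if "(\<gamma> has_vector_derivative v) (at t within {b..c})" "b < t" for t v
  proof -
    have "at t within {a..c} = at t within {b..c}"
      by (rule at_within_nhd[of _ "{b<..}"]) (use that le in auto)
    with that show ?thesis by simp
  qed
  have off: "t < b \<or> b < t" if "fst (\<gamma> t) \<noteq> 0" for t
    using that b by (metis linorder_neqE mem_Collect_eq switching_line_def)
  have "finite {t \<in> {a'..b'}. \<gamma> t \<in> switching_line}" if sub: "{a'..b'} \<subseteq> {a..c}" for a' b'
  proof (rule finite_subset)
    show "{t \<in> {a'..b'}. \<gamma> t \<in> switching_line}
        \<subseteq> {t \<in> {a..b}. \<gamma> t \<in> switching_line} \<union> {t \<in> {b..c}. \<gamma> t \<in> switching_line}"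
      using sub un by auto
    show "finite ({t \<in> {a..b}. \<gamma> t \<in> switching_line} \<union> {t \<in> {b..c}. \<gamma> t \<in> switching_line})"
      using I J unfolding crossing_solution_def by blast
  qed
  moreover have "continuous_on {a..c} \<gamma>"
    using I J unfolding un crossing_solution_def by (auto intro!: continuous_on_closed_Un)
  moreover have "\<forall>t\<in>{a..c}. fst (\<gamma> t) < 0 \<longrightarrow> (\<gamma> has_vector_derivative X (\<gamma> t)) (at t within {a..c})"
    using I J off left right unfolding crossing_solution_def un[symmetric]
    by (smt (verit, best) atLeastAtMost_iff)
  moreover have "\<forall>t\<in>{a..c}. fst (\<gamma> t) > 0 \<longrightarrow> (\<gamma> has_vector_derivative Y (\<gamma> t)) (at t within {a..c})"
    using I J off left right unfolding crossing_solution_def un[symmetric]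
    by (smt (verit, best) atLeastAtMost_iff)
  moreover have "\<forall>t\<in>{a..c}. \<gamma> t \<in> switching_line \<longrightarrow> \<gamma> t \<in> crossing_points X Y"
    using I J unfolding crossing_solution_def un by blast
  ultimately show ?thesis unfolding crossing_solution_def by blast
qed

lemma crossing_solution_exhaust:
  assumes "\<And>r::real. 0 < r \<Longrightarrow> crossing_solution X Y (I \<inter> {- r<..<r}) \<gamma>"
  shows "crossing_solution X Y I \<gamma>"
proof -
  have loc: "crossing_solution X Y (I \<inter> {- r<..<r}) \<gamma>" if "0 < r" for r using assms that .
  have nhd: "at t within I \<inter> {- (\<bar>t\<bar> + 1)<..<\<bar>t\<bar> + 1} = at t within I" for t :: real
    by (rule at_within_nhd[of _ "{- (\<bar>t\<bar> + 1)<..<\<bar>t\<bar> + 1}"]) auto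
  have mem: "t \<in> I \<inter> {- (\<bar>t\<bar> + 1)<..<\<bar>t\<bar> + 1}" if "t \<in> I" for t using that by auto
  have pos: "0 < \<bar>t\<bar> + 1" for t :: real by simp
  have "continuous_on I \<gamma>"
    unfolding continuous_on_eq_continuous_within
  proof
    fix t assume t: "t \<in> I"
    then have "continuous (at t within I \<inter> {- (\<bar>t\<bar> + 1)<..<\<bar>t\<bar> + 1}) \<gamma>"
      using loc[OF pos[of t]] mem unfolding crossing_solution_def
      by (metis continuous_on_eq_continuous_within)
    then show "continuous (at t within I) \<gamma>" unfolding nhd .
  qed
  moreover have "(\<gamma> has_vector_derivative X (\<gamma> t)) (at t within I)"
    if "t \<in> I" "fst (\<gamma> t) < 0" for t
    using loc[OF pos[of t]] mem[OF that(1)] that(2) unfolding crossing_solution_def nhd[of t, symmetric]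
    by blast
  moreover have "(\<gamma> has_vector_derivative Y (\<gamma> t)) (at t within I)"
    if "t \<in> I" "fst (\<gamma> t) > 0" for t
    using loc[OF pos[of t]] mem[OF that(1)] that(2) unfolding crossing_solution_def nhd[of t, symmetric]
    by blast
  moreover have "\<gamma> t \<in> crossing_points X Y" if "t \<in> I" "\<gamma> t \<in> switching_line" for t
    using loc[OF pos[of t]] mem[OF that(1)] that(2) unfolding crossing_solution_def
    by blast
  moreover have "finite {t \<in> {a..b}. \<gamma> t \<in> switching_line}" if "{a..b} \<subseteq> I" for a b
  proof -
    have "{a..b} \<subseteq> I \<inter> {- (\<bar>a\<bar> + \<bar>b\<bar> + 1)<..<\<bar>a\<bar> + \<bar>b\<bar> + 1}" using that by auto
    moreover have "0 < \<bar>a\<bar> + \<bar>b\<bar> + 1" by simp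
    ultimately show ?thesis
      using loc[of "\<bar>a\<bar> + \<bar>b\<bar> + 1"] unfolding crossing_solution_def by blast
  qed
  ultimately show ?thesis unfolding crossing_solution_def by blast
qed

lemma crossing_solution_chain:
  fixes T :: "nat \<Rightarrow> real"
  assumes pieces: "\<And>n. crossing_solution X Y {T n..T (Suc n)} \<gamma>"
    and joints: "\<And>n. \<gamma> (T (Suc n)) \<in> switching_line"
    and mono: "\<And>n. T n \<le> T (Suc n)" and lim: "filterlim T at_top sequentially"
  shows "crossing_solution X Y {T 0..} \<gamma>"
proof (rule crossing_solution_exhaust)
  have T: "T 0 \<le> T n" for n using lift_Suc_mono_le[of T 0 n] mono by simp
  have fin: "crossing_solution X Y {T 0..T (Suc n)} \<gamma>" for n
  proof (induction n)
    case (Suc n)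
    show ?case
      by (rule crossing_solution_glue[OF Suc.IH pieces joints]) (use T mono in auto)
  qed (rule pieces)
  fix r :: real assume "0 < r"
  from lim have "eventually (\<lambda>n. r \<le> T n) sequentially" by (simp add: filterlim_at_top)
  then obtain n where "\<And>m. n \<le> m \<Longrightarrow> r \<le> T m" by (auto simp: eventually_sequentially)
  then have "r \<le> T (Suc n)" by simp
  then have "{T 0..} \<inter> {- r<..<r} \<subseteq> {T 0..T (Suc n)}" by auto
  with fin show "crossing_solution X Y ({T 0..} \<inter> {- r<..<r}) \<gamma>"
    by (rule crossing_solution_subset)
qed

lemma obtain_enclosing_index:
  fixes T :: "nat \<Rightarrow> real"
  assumes "filterlim T at_top sequentially" "T N \<le> t"
  obtains n where "N \<le> n" "T n \<le> t" "t < T (Suc n)"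
proof -
  have "eventually (\<lambda>n. t + 1 \<le> T n) sequentially"
    using assms(1) by (simp add: filterlim_at_top)
  then obtain M where "\<And>n. n \<ge> M \<Longrightarrow> t + 1 \<le> T n" by (auto simp: eventually_sequentially)
  then have ex: "N \<le> max N M \<and> t < T (max N M)" by (smt (verit) max.cobounded1 max.cobounded2)
  define m where "m = (LEAST m. N \<le> m \<and> t < T m)"
  have m: "N \<le> m" "t < T m" using LeastI[of "\<lambda>m. N \<le> m \<and> t < T m", OF ex] by (auto simp: m_def)
  with assms have "m \<noteq> N" by auto
  with m obtain n where n: "m = Suc n" "N \<le> n" by (metis le_Suc_eq le_antisym not0_implies_Suc le0)
  have "\<not> (N \<le> n \<and> t < T n)" using not_less_Least[of n "\<lambda>m. N \<le> m \<and> t < T m"] n by (simp add: m_def)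
  with n m that show ?thesis by auto
qed

text \<open>
  Arcs whose durations are bounded below concatenate to a solution on the whole half-line:
  the crossing times cannot accumulate.
\<close>

lemma crossing_solution_forever:
  assumes step: "\<And>z. z \<in> S \<Longrightarrow>
      \<exists>\<tau> \<alpha>. c \<le> \<tau> \<and> \<alpha> 0 = z \<and> crossing_solution X Y {0..\<tau>} \<alpha> \<and> \<alpha> \<tau> \<in> S"
    and c: "0 < c" and S: "S \<subseteq> switching_line" and z: "z \<in> S"
  obtains \<gamma> where "crossing_solution X Y {0..} \<gamma>" "\<gamma> 0 = z"
proof -
  obtain D A where DA: "\<And>z. z \<in> S \<Longrightarrow> c \<le> D z \<and> A z 0 = z \<and>
      crossing_solution X Y {0..D z} (A z) \<and> A z (D z) \<in> S"
    using step by metis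
  define Z where "Z n = ((\<lambda>z. A z (D z)) ^^ n) z" for n
  define T where "T n = (\<Sum>k<n. D (Z k))" for n
  define idx where "idx t = (THE n. T n \<le> t \<and> t < T (Suc n))" for t
  define \<gamma> where "\<gamma> t = A (Z (idx t)) (t - T (idx t))" for t
  have ZS: "Z n \<in> S" for n
    by (induction n) (use z DA in \<open>auto simp: Z_def\<close>)
  have Z_Suc: "Z (Suc n) = A (Z n) (D (Z n))" for n by (simp add: Z_def)
  have T_Suc: "T (Suc n) = T n + D (Z n)" for n by (simp add: T_def)
  have Tless: "T n < T (Suc n)" for n using T_Suc[of n] DA[OF ZS[of n]] c by linarith
  have Tle: "T n \<le> T (Suc n)" for n using Tless by (rule less_imp_le)
  have Tmono: "n \<le> m \<Longrightarrow> T n \<le> T m" for n m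
    using lift_Suc_mono_le[of T n m] less_imp_le[OF Tless] by simp
  have growth: "c * real n \<le> T n" for n
  proof (induction n)
    case (Suc n)
    then show ?case using DA[OF ZS[of n]] by (simp add: T_Suc distrib_left)
  qed (simp add: T_def)
  have "filterlim (\<lambda>n. c * real n) at_top sequentially"
    by (intro filterlim_tendsto_pos_mult_at_top[OF tendsto_const c] filterlim_real_sequentially)
  then have lim: "filterlim T at_top sequentially"
    by (rule filterlim_at_top_mono) (simp add: growth)
  have idx: "idx t = n" if "T n \<le> t" "t < T (Suc n)" for t n
    unfolding idx_def
  proof (rule the_equality)
    fix m assume m: "T m \<le> t \<and> t < T (Suc m)"
    show "m = n"
    proof (rule ccontr)
      assume "m \<noteq> n"
      then consider "Suc m \<le> n" | "Suc n \<le> m" by linarith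
      then show False
      proof cases
        case 1
        then show False using Tmono[OF 1] m that by linarith
      next
        case 2
        then show False using Tmono[OF 2] m that by linarith
      qed
    qed
  qed (use that in auto)
  have at_T: "\<gamma> (T n) = Z n" for n
    using idx[of n "T n"] Tless DA[OF ZS[of n]] by (simp add: \<gamma>_def)
  have \<gamma>_piece: "\<gamma> t = A (Z n) (t - T n)" if t: "t \<in> {T n..T (Suc n)}" for t n
  proof (cases "t = T (Suc n)")
    case True
    then show ?thesis using at_T[of "Suc n"] by (simp add: Z_Suc T_Suc)
  next
    case False
    then have "idx t = n" using t by (intro idx) auto
    then show ?thesis by (simp add: \<gamma>_def)
  qed
  have "crossing_solution X Y {T n..T (Suc n)} \<gamma>" for n
  proof (rule crossing_solution_cong)
    show "crossing_solution X Y {T n..T (Suc n)} (\<lambda>t. A (Z n) (t - T n))"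
      using DA[OF ZS[of n]] by (intro crossing_solution_shift[of _ _ "{0..D (Z n)}"]) (auto simp: T_Suc)
  qed (rule \<gamma>_piece[symmetric])
  then have "crossing_solution X Y {T 0..} \<gamma>"
    using ZS S by (intro crossing_solution_chain Tle lim) (auto simp: at_T)
  moreover have "T 0 = 0" "Z 0 = z" by (simp_all add: T_def Z_def)
  ultimately have "crossing_solution X Y {0..} \<gamma>" "\<gamma> 0 = z"
    using at_T[of 0] by simp_all
  then show ?thesis by (rule that)
qed

lemma crossing_solution_prepend:
  assumes \<alpha>: "crossing_solution X Y {0..\<tau>} \<alpha>" and \<beta>: "crossing_solution X Y {0..} \<beta>"
    and joint: "\<alpha> \<tau> = \<beta> 0" "\<beta> 0 \<in> switching_line" and "0 \<le> \<tau>"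
  shows "crossing_solution X Y {0..} (\<lambda>t. if t \<le> \<tau> then \<alpha> t else \<beta> (t - \<tau>))"
proof (rule crossing_solution_exhaust)
  let ?\<gamma> = "\<lambda>t. if t \<le> \<tau> then \<alpha> t else \<beta> (t - \<tau>)"
  fix r :: real assume "0 < r"
  have "crossing_solution X Y {0..\<tau>} ?\<gamma>"
    by (rule crossing_solution_cong[OF \<alpha>]) simp
  moreover have "crossing_solution X Y {\<tau>..\<tau> + r} ?\<gamma>"
  proof (rule crossing_solution_cong)
    show "crossing_solution X Y {\<tau>..\<tau> + r} (\<lambda>t. \<beta> (t - \<tau>))"
      by (rule crossing_solution_shift[OF \<beta>]) simp
  qed (use joint in auto)
  ultimately have "crossing_solution X Y {0..\<tau> + r} ?\<gamma>"
    by (rule crossing_solution_glue) (use joint \<open>0 \<le> \<tau>\<close> \<open>0 < r\<close> in auto)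
  then show "crossing_solution X Y ({0..} \<inter> {- r<..<r}) ?\<gamma>"
    by (rule crossing_solution_subset) (use \<open>0 \<le> \<tau>\<close> in auto)
qed

section \<open>Two virtual nodes on either side of a line\<close>

text \<open>
  The half-turn that exchanges the two half-planes. It lets every statement about arcs in
  \<open>x < 0\<close> be reused in \<open>x > 0\<close>.
\<close>

definition flip :: "real \<Rightarrow> real \<times> real \<Rightarrow> real \<times> real" where
  "flip s z = (- fst z, s - snd z)"

definition mirrored :: "real \<Rightarrow> planar_field \<Rightarrow> planar_field" where
  "mirrored s F z = - F (flip s z)"

lemma flip_simps [simp]:
  "fst (flip s z) = - fst z" "snd (flip s z) = s - snd z" "flip s (flip s z) = z"
  by (simp_all add: flip_def)

lemma dist_flip [simp]: "dist (flip s z) (flip s z') = dist z z'"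
  by (simp add: flip_def dist_prod_def dist_minus dist_real_def abs_minus_commute)

lemma flip_in_switching_line [simp]: "flip s z \<in> switching_line \<longleftrightarrow> z \<in> switching_line"
  by (simp add: switching_line_def)

lemma continuous_on_flip [continuous_intros]:
  "continuous_on S f \<Longrightarrow> continuous_on S (\<lambda>t. flip s (f t))"
  unfolding flip_def by (intro continuous_intros)

lemma flip_has_vector_derivative:
  assumes "(\<gamma> has_vector_derivative v) (at t within I)"
  shows "((\<lambda>t. flip s (\<gamma> t)) has_vector_derivative - v) (at t within I)"
proof -
  have "(\<lambda>t. flip s (\<gamma> t)) = (\<lambda>t. (0, s) - \<gamma> t)"
    by (simp add: flip_def fun_eq_iff prod_eq_iff)
  then show ?thesis using assms by (auto intro!: derivative_eq_intros)
qed

lemma crossing_solution_flip: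
  assumes sol: "crossing_solution F (mirrored s G) I \<gamma>"
  shows "crossing_solution G (mirrored s F) I (\<lambda>t. flip s (\<gamma> t))"
proof -
  have "flip s z \<in> crossing_points G (mirrored s F)" if "z \<in> crossing_points F (mirrored s G)" for z
    using that by (simp add: crossing_points_def mirrored_def mult.commute)
  moreover have "((\<lambda>t. flip s (\<gamma> t)) has_vector_derivative G (flip s (\<gamma> t))) (at t within I)"
    if "(\<gamma> has_vector_derivative mirrored s G (\<gamma> t)) (at t within I)" for t
    using flip_has_vector_derivative[OF that] by (simp add: mirrored_def)
  moreover have "((\<lambda>t. flip s (\<gamma> t)) has_vector_derivative mirrored s F (flip s (\<gamma> t))) (at t within I)"
    if "(\<gamma> has_vector_derivative F (\<gamma> t)) (at t within I)" for t
    using flip_has_vector_derivative[OF that] by (simp add: mirrored_def)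
  ultimately show ?thesis
    using crossing_solutionD[OF sol] unfolding crossing_solution_def by (simp add: continuous_on_flip)
qed

locale two_nodes = L: node p0 q0 a0 + R: node p1 q1 a1
  for p0 q0 a0 p1 q1 a1 :: real +
  fixes s :: real
begin

abbreviation left_field where "left_field \<equiv> L.field"
abbreviation right_field where "right_field \<equiv> mirrored s R.field"

abbreviation sol :: "real set \<Rightarrow> (real \<Rightarrow> real \<times> real) \<Rightarrow> bool" where
  "sol \<equiv> crossing_solution left_field right_field"

lemma crossing_iff:
  "z \<in> crossing_points left_field right_field \<longleftrightarrow>
     fst z = 0 \<and> (max 0 s < snd z \<or> snd z < min 0 s)"
  by (auto simp: crossing_points_def switching_line_def L.field_def R.field_def mirrored_def
      zero_less_mult_iff)

lemma sol_crosses: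
  "sol I \<gamma> \<Longrightarrow> t \<in> I \<Longrightarrow> fst (\<gamma> t) = 0 \<Longrightarrow> max 0 s < snd (\<gamma> t) \<or> snd (\<gamma> t) < min 0 s"
  using crossing_solutionD(4)[of left_field right_field I \<gamma> t] crossing_iff[of "\<gamma> t"] by (simp add: switching_line_def)

text \<open>
  Crossing times are locally finite, so \<open>x\<close> has a constant sign just after an upper crossing
  point. It cannot be positive, since the right field points to the left there.
\<close>

lemma sol_turns_left:
  assumes sol: "sol {t0..} \<gamma>" and start: "L.entering (\<gamma> t0)"
  obtains d where "t0 < d" "\<And>t. t0 < t \<Longrightarrow> t < d \<Longrightarrow> fst (\<gamma> t) < 0"
proof -
  have cont: "continuous_on {t0..} (\<lambda>t. fst (\<gamma> t))"
    by (intro continuous_intros crossing_solutionD(1)[OF sol])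
  have right_limit: "(f \<longlongrightarrow> f t0) (at_right t0)" if "continuous_on {t0..} f" for f :: "real \<Rightarrow> real"
  proof -
    have "continuous_on {t0..t0 + 1} f" by (rule continuous_on_subset[OF that]) auto
    then show ?thesis by (rule continuous_on_Icc_at_rightD) simp
  qed
  show ?thesis
  proof (cases "fst (\<gamma> t0) < 0")
    case True
    from order_tendstoD(2)[OF right_limit[OF cont] this] that show ?thesis
      by (auto simp: eventually_at_right_field)
  next
    case False
    with start sol_crosses[OF sol, of t0] have y: "fst (\<gamma> t0) = 0" "s < snd (\<gamma> t0)"
      by (auto simp: L.entering_def)
    let ?v = "\<lambda>t. fst (right_field (\<gamma> t))"
    have "continuous_on {t0..} ?v"
      unfolding mirrored_def R.field_def
      by (simp, intro continuous_intros crossing_solutionD(1)[OF sol])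
    moreover have "?v t0 < 0" using y by (simp add: mirrored_def R.field_def)
    ultimately have "eventually (\<lambda>t. ?v t < 0) (at_right t0)"
      using order_tendstoD(2)[OF right_limit] by blast
    then obtain b where b: "t0 < b" "\<And>t. t0 < t \<Longrightarrow> t < b \<Longrightarrow> ?v t < 0"
      by (auto simp: eventually_at_right_field)
    define Z where "Z = {t \<in> {t0..t0 + 1}. \<gamma> t \<in> switching_line} \<inter> {t0<..}"
    have "finite {t \<in> {t0..t0 + 1}. \<gamma> t \<in> switching_line}"
      by (intro crossing_solutionD(5)[OF sol]) auto
    then have fin: "finite (insert (t0 + 1) Z)" by (simp add: Z_def)
    define d where "d = min b (Min (insert (t0 + 1) Z))"
    have d: "t0 < d" "d \<le> b" "d \<le> t0 + 1"
      using b Min_in[OF fin] Min_le[OF fin, of "t0 + 1"] by (auto simp: d_def Z_def)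
    have nonzero: "fst (\<gamma> t) \<noteq> 0" if "t0 < t" "t < d" for t
    proof
      assume "fst (\<gamma> t) = 0"
      with that d have "t \<in> Z" by (auto simp: Z_def switching_line_def)
      with Min_le[OF fin, of t] that show False by (auto simp: d_def)
    qed
    have "fst (\<gamma> t) < 0" if t: "t0 < t" "t < d" for t
    proof (rule ccontr)
      assume "\<not> fst (\<gamma> t) < 0"
      with nonzero t have pos: "0 < fst (\<gamma> t)" by force
      \<comment> \<open>The curve would stay in \<open>x > 0\<close>, where \<open>x\<close> decreases, starting from \<open>x = 0\<close>.\<close>
      have "fst (\<gamma> t) < fst (\<gamma> t0)"
      proof (rule DERIV_neg_imp_decreasing_open[OF t(1)])
        fix r assume r: "t0 < r" "r < t"
        have "0 < fst (\<gamma> r)"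
        proof (rule ccontr)
          assume "\<not> 0 < fst (\<gamma> r)"
          moreover have "continuous_on {r..t} (\<lambda>t. fst (\<gamma> t))"
            using r by (intro continuous_on_subset[OF cont]) auto
          ultimately have "\<exists>x. r \<le> x \<and> x \<le> t \<and> fst (\<gamma> x) = 0"
            using pos r by (intro IVT') auto
          then obtain x where "r \<le> x" "x \<le> t" "fst (\<gamma> x) = 0" by blast
          with nonzero[of x] r t show False by simp
        qed
        with r have "(\<gamma> has_vector_derivative right_field (\<gamma> r)) (at r within {t0..})"
          by (intro crossing_solutionD(3)[OF sol]) auto
        then have "(\<gamma> has_vector_derivative right_field (\<gamma> r)) (at r)"
          using r at_within_interior[of r "{t0..}"] by simp
        from has_derivative_fst[OF this[unfolded has_vector_derivative_def]]
        have "((\<lambda>t. fst (\<gamma> t)) has_real_derivative ?v r) (at r)"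
          by (simp add: has_real_derivative_iff_has_vector_derivative has_vector_derivative_def)
        moreover have "?v r < 0" using b r t d by auto
        ultimately show "\<exists>v. ((\<lambda>t. fst (\<gamma> t)) has_real_derivative v) (at r) \<and> v < 0" by blast
      qed (use continuous_on_subset[OF cont] in auto)
      with pos y show False by simp
    qed
    with d that show ?thesis by blast
  qed
qed

text \<open>
  An arc of any solution is an arc of the flow: were the solution to come back to the line
  earlier, it would agree with the flow up to that time, which is then a return time of the flow.
\<close>

lemma sol_follows_left_arc:
  assumes sol: "sol {t0..} \<gamma>" and start: "L.entering (\<gamma> t0)"
    and neg: "\<And>t. 0 < t \<Longrightarrow> t < \<tau> \<Longrightarrow> fst (L.flow t (\<gamma> t0)) < 0"
    and t: "t \<in> {0..\<tau>}"
  shows "\<gamma> (t0 + t) = L.flow t (\<gamma> t0)"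
proof -
  obtain d where d: "t0 < d" "\<And>t. t0 < t \<Longrightarrow> t < d \<Longrightarrow> fst (\<gamma> t) < 0"
    using sol_turns_left[OF sol start] by blast
  have cont: "continuous_on {t0..} \<gamma>" by (rule crossing_solutionD(1)[OF sol])
  have agree: "\<gamma> r = L.flow (r - t0) (\<gamma> t0)"
    if c: "\<And>t. t0 < t \<Longrightarrow> t < c \<Longrightarrow> fst (\<gamma> t) < 0" and r: "r \<in> {t0..c}" for r c
  proof (rule L.solution_eq_flow[OF _ _ r])
    show "continuous_on {t0..c} \<gamma>" by (rule continuous_on_subset[OF cont]) auto
    fix t assume t: "t0 < t" "t < c"
    then have "(\<gamma> has_vector_derivative L.field (\<gamma> t)) (at t within {t0..})"
      using c by (intro crossing_solutionD(2)[OF sol]) auto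
    then show "(\<gamma> has_vector_derivative L.field (\<gamma> t)) (at t)"
      using t at_within_interior[of t "{t0..}"] by simp
  qed
  have "fst (\<gamma> r) < 0" if r: "t0 < r" "r < t0 + \<tau>" for r
  proof (rule ccontr)
    assume "\<not> fst (\<gamma> r) < 0"
    then have "0 \<le> fst (\<gamma> r)" by simp
    moreover have "continuous_on {t0..r} (\<lambda>t. fst (\<gamma> t))"
      by (intro continuous_intros continuous_on_subset[OF cont]) auto
    ultimately obtain c where c: "t0 < c" "c \<le> r" "fst (\<gamma> c) = 0"
      "\<And>t. t0 < t \<Longrightarrow> t < c \<Longrightarrow> fst (\<gamma> t) < 0"
      using first_zero[of t0 d "\<lambda>t. fst (\<gamma> t)" r] d r by blast
    have "\<gamma> c = L.flow (c - t0) (\<gamma> t0)" using agree[of c c] c by auto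
    with neg[of "c - t0"] c r show False by auto
  qed
  from agree[of "t0 + \<tau>" "t0 + t", OF this] t show ?thesis by simp
qed

lemma left_arc_is_sol:
  assumes start: "L.entering z" "fst z = 0 \<Longrightarrow> s < snd z" and "0 < \<tau>"
    and neg: "\<And>t. 0 < t \<Longrightarrow> t < \<tau> \<Longrightarrow> fst (L.flow t z) < 0"
    and land: "fst (L.flow \<tau> z) = 0" "snd (L.flow \<tau> z) < min 0 s"
  shows "sol {0..\<tau>} (\<lambda>t. L.flow t z)"
proof -
  have ends: "t = 0 \<or> t = \<tau>" if "t \<in> {0..\<tau>}" "fst (L.flow t z) = 0" for t
    using neg[of t] that by force
  have nonpos: "\<not> 0 < fst (L.flow t z)" if "t \<in> {0..\<tau>}" for t
  proof (cases "t = 0 \<or> t = \<tau>")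
    case True
    then show ?thesis using start land by (auto simp: L.entering_def)
  next
    case False
    with neg[of t] that show ?thesis by auto
  qed
  have "L.flow t z \<in> crossing_points left_field right_field"
    if t: "t \<in> {0..\<tau>}" and sw: "L.flow t z \<in> switching_line" for t
  proof -
    have "fst (L.flow t z) = 0" using sw by (simp add: switching_line_def)
    with ends[OF t] start land show ?thesis by (auto simp: crossing_iff L.entering_def)
  qed
  moreover have "finite {t \<in> {a..b}. L.flow t z \<in> switching_line}" if "{a..b} \<subseteq> {0..\<tau>}" for a b
  proof (rule finite_subset)
    show "{t \<in> {a..b}. L.flow t z \<in> switching_line} \<subseteq> {0, \<tau>}"
    proof
      fix t assume t: "t \<in> {t \<in> {a..b}. L.flow t z \<in> switching_line}"
      with that have "t \<in> {0..\<tau>}" by blast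
      with ends[of t] t show "t \<in> {0, \<tau>}" by (auto simp: switching_line_def)
    qed
  qed simp
  moreover have "continuous_on {0..\<tau>} (\<lambda>t. L.flow t z)" by (intro continuous_intros)
  ultimately show ?thesis
    using nonpos L.flow_has_vector_derivative unfolding crossing_solution_def by blast
qed

end

context two_nodes
begin

lemma swapped: "two_nodes p1 q1 a1 p0 q0 a0"
  by unfold_locales

lemma sol_subset: "sol I \<gamma> \<Longrightarrow> J \<subseteq> I \<Longrightarrow> sol J \<gamma>"
  by (rule crossing_solution_subset)

lemma upper_entering: "max 0 s < y \<Longrightarrow> L.entering (0, y)"
  by (simp add: L.entering_def)

lemma sol_left_arc:
  assumes sol: "sol {t0..} \<gamma>" and start: "\<gamma> t0 = (0, y)" and y: "max 0 s < y"
  shows "\<And>t. t \<in> {0..L.flight y} \<Longrightarrow> \<gamma> (t0 + t) = L.flow t (0, y)"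
    and "\<gamma> (t0 + L.flight y) = (0, - L.transit y)"
    and "- L.transit y < min 0 s"
proof -
  have y0: "0 < y" using y by simp
  show arc: "\<gamma> (t0 + t) = L.flow t (0, y)" if "t \<in> {0..L.flight y}" for t
    using sol_follows_left_arc[OF sol, of "L.flight y" t] that start upper_entering[OF y]
      L.fst_flow_before_flight[OF y0] by simp
  have fp: "0 < L.flight y" using y0 by (rule L.flight_pos)
  show land: "\<gamma> (t0 + L.flight y) = (0, - L.transit y)"
    using arc[of "L.flight y"] fp L.flow_flight[OF y0] by simp
  show "- L.transit y < min 0 s"
    using sol_crosses[OF sol, of "t0 + L.flight y"] fp land L.transit_pos[OF y0] by simp
qed

lemma sol_right_arc:
  assumes sol: "sol {t0..} \<gamma>" and start: "\<gamma> t0 = (0, y)" and y: "y < min 0 s"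
  shows "\<And>t. t \<in> {0..R.flight (s - y)} \<Longrightarrow> \<gamma> (t0 + t) = flip s (R.flow t (0, s - y))"
    and "\<gamma> (t0 + R.flight (s - y)) = (0, s + R.transit (s - y))"
    and "max 0 s < s + R.transit (s - y)"
proof -
  interpret swap: two_nodes p1 q1 a1 p0 q0 a0 s by (rule swapped)
  have sol': "swap.sol {t0..} (\<lambda>t. flip s (\<gamma> t))"
    by (rule crossing_solution_flip[OF sol])
  have start': "flip s (\<gamma> t0) = (0, s - y)" by (simp add: start flip_def)
  have y': "max 0 s < s - y" using y by auto
  note arc = swap.sol_left_arc[OF sol' start' y']
  have unflip: "flip s z = z' \<Longrightarrow> z = flip s z'" for z z' by (metis flip_simps(3))
  show "\<gamma> (t0 + t) = flip s (R.flow t (0, s - y))" if "t \<in> {0..R.flight (s - y)}" for t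
    using arc(1)[OF that] by (rule unflip)
  show "\<gamma> (t0 + R.flight (s - y)) = (0, s + R.transit (s - y))"
    using unflip[OF arc(2)] by (simp add: flip_def)
  show "max 0 s < s + R.transit (s - y)" using arc(3) by auto
qed

text \<open>
  One turn starts at an upper crossing point \<open>(0, y)\<close>, runs through a left and a right arc, and
  ends at the upper crossing point \<open>(0, return y)\<close>. The right arc is computed in flipped
  coordinates, where it starts at height \<open>s + L.transit y\<close>.
\<close>

definition period :: "real \<Rightarrow> real" where
  "period y = L.flight y + R.flight (s + L.transit y)"

definition turn :: "real \<Rightarrow> real \<Rightarrow> real \<times> real" where
  "turn y t = (if t \<le> L.flight y then L.flow t (0, y)
     else flip s (R.flow (t - L.flight y) (0, s + L.transit y)))"

definition return :: "real \<Rightarrow> real" where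
  "return y = s + R.transit (s + L.transit y)"

lemma sol_turn:
  assumes sol: "sol {t0..} \<gamma>" and start: "\<gamma> t0 = (0, y)" and y: "max 0 s < y"
  shows "0 < s + L.transit y"
    and "\<And>t. t \<in> {0..period y} \<Longrightarrow> \<gamma> (t0 + t) = turn y t"
    and "\<gamma> (t0 + period y) = (0, return y)"
    and "max 0 s < return y"
proof -
  note left = sol_left_arc[OF sol start y]
  have fp: "0 < L.flight y" using y by (intro L.flight_pos) simp
  have "sol {t0 + L.flight y..} \<gamma>" using fp by (intro sol_subset[OF sol]) auto
  note right = sol_right_arc[OF this left(2,3)]
  show "0 < s + L.transit y" using left(3) by auto
  show "\<gamma> (t0 + period y) = (0, return y)"
    using right(2) by (simp add: period_def return_def add.assoc)
  show "max 0 s < return y" using right(3) by (simp add: return_def)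
  show "\<gamma> (t0 + t) = turn y t" if "t \<in> {0..period y}" for t
    using left(1)[of t] right(1)[of "t - L.flight y"] that
    by (auto simp: turn_def period_def)
qed

lemma entering_reaches_lower:
  assumes sol: "sol {t0..} \<gamma>" and start: "L.entering (\<gamma> t0)"
  obtains t1 where "t0 \<le> t1" "fst (\<gamma> t1) = 0" "snd (\<gamma> t1) < min 0 s"
proof -
  obtain \<tau> where \<tau>: "0 < \<tau>" "fst (L.flow \<tau> (\<gamma> t0)) = 0" "snd (L.flow \<tau> (\<gamma> t0)) < 0"
    "\<And>t. 0 < t \<Longrightarrow> t < \<tau> \<Longrightarrow> fst (L.flow t (\<gamma> t0)) < 0"
    using L.first_return[OF start] by blast
  have "\<gamma> (t0 + \<tau>) = L.flow \<tau> (\<gamma> t0)"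
    using \<tau> by (intro sol_follows_left_arc[OF sol start \<tau>(4)]) auto
  then show ?thesis using that[of "t0 + \<tau>"] sol_crosses[OF sol, of "t0 + \<tau>"] \<tau> by auto
qed

lemma sol_reaches_upper:
  assumes sol: "sol {t0..} \<gamma>"
  obtains t1 y where "t0 \<le> t1" "max 0 s < y" "\<gamma> t1 = (0, y)"
proof -
  interpret swap: two_nodes p1 q1 a1 p0 q0 a0 s by (rule swapped)
  obtain t1 where t1: "t0 \<le> t1" "0 < fst (\<gamma> t1) \<or> fst (\<gamma> t1) = 0 \<and> snd (\<gamma> t1) < min 0 s"
  proof (cases "L.entering (\<gamma> t0)")
    case True
    then show ?thesis using entering_reaches_lower[OF sol] that by metis
  next
    case False
    then show ?thesis
      using that[of t0] sol_crosses[OF sol, of t0] by (auto simp: L.entering_def not_less less_le)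
  qed
  have "swap.sol {t1..} (\<lambda>t. flip s (\<gamma> t))"
    using t1 by (intro crossing_solution_flip sol_subset[OF sol]) auto
  moreover have "R.entering (flip s (\<gamma> t1))" using t1 by (auto simp: R.entering_def)
  ultimately obtain t2 where t2: "t1 \<le> t2" "fst (flip s (\<gamma> t2)) = 0"
    "snd (flip s (\<gamma> t2)) < min 0 s"
    by (rule swap.entering_reaches_lower)
  then have "max 0 s < snd (\<gamma> t2)" "\<gamma> t2 = (0, snd (\<gamma> t2))" by (auto simp: prod_eq_iff)
  moreover have "t0 \<le> t2" using t1 t2 by simp
  ultimately show ?thesis using that by blast
qed

text \<open>
  A periodic orbit leaves a nonempty finite set of heights that the return map sends into itself.
  For finite sets, extremal elements then decide which heights are possible.
\<close>

lemma periodic_orbit_heights: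
  assumes "crossing_periodic_orbit left_field right_field \<Gamma>"
  defines "U \<equiv> {y. max 0 s < y \<and> (0, y) \<in> \<Gamma>}"
  shows "finite U" and "U \<noteq> {}" and "\<And>y. y \<in> U \<Longrightarrow> return y \<in> U"
    and "\<And>y. y \<in> U \<Longrightarrow> 0 < s + L.transit y"
proof -
  obtain \<gamma> where sol: "sol UNIV \<gamma>" and \<Gamma>: "\<Gamma> = range \<gamma>"
    and fin: "finite (\<Gamma> \<inter> switching_line)"
    using assms(1) unfolding crossing_periodic_orbit_def by auto
  have "Pair 0 ` U \<subseteq> \<Gamma> \<inter> switching_line" by (auto simp: U_def switching_line_def)
  then show "finite U" using fin by (metis finite_imageD finite_subset inj_on_def prod.inject)
  have sol': "sol {t..} \<gamma>" for t by (rule sol_subset[OF sol]) simp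
  obtain t1 y where "max 0 s < y" "\<gamma> t1 = (0, y)" by (rule sol_reaches_upper[OF sol'[of 0]])
  then have "y \<in> U" using rangeI[of \<gamma> t1] by (simp add: U_def \<Gamma>)
  then show "U \<noteq> {}" by blast
  fix y assume "y \<in> U"
  then obtain t where t: "\<gamma> t = (0, y)" and y: "max 0 s < y" by (auto simp: U_def \<Gamma>)
  note turn = sol_turn[OF sol' t y]
  show "return y \<in> U" using turn(3,4) unfolding U_def \<Gamma> by (auto simp: image_iff) metis
  show "0 < s + L.transit y" by (rule turn(1))
qed

text \<open>
  Both half return maps satisfy \<open>transit y < y\<close>, so for \<open>s \<le> 0\<close> every turn ends strictly below
  its start, and none of the finitely many crossing heights can be the least.
\<close>

lemma no_periodic_orbit:
  assumes "s \<le> 0" shows "\<not> crossing_periodic_orbit left_field right_field \<Gamma>"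
proof
  assume orbit: "crossing_periodic_orbit left_field right_field \<Gamma>"
  define U where "U = {y. max 0 s < y \<and> (0, y) \<in> \<Gamma>}"
  note U = periodic_orbit_heights[OF orbit, folded U_def]
  have MinU: "Min U \<in> U" using U by simp
  then have y: "0 < Min U" by (simp add: U_def)
  have "return (Min U) < s + (s + L.transit (Min U))"
    unfolding return_def using R.transit_less[OF U(4)[OF MinU]] by simp
  also have "\<dots> < Min U" using L.transit_less[OF y] assms by simp
  finally show False using Min_le[OF U(1) U(3)[OF MinU]] by simp
qed

end

section \<open>The return map when there is an escaping segment\<close>

text \<open>
  The map is increasing, so its iterates approach the fixed point monotonically from one side;
  being continuous, it fixes their limit, and a strict contraction has no second fixed point.
\<close>

lemma contraction_iterates_tendsto:
  fixes G :: "real \<Rightarrow> real"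
  assumes contr: "\<And>x y. l < x \<Longrightarrow> x < y \<Longrightarrow> 0 < G y - G x \<and> G y - G x < y - x"
    and fixpt: "G a = a" and "l < a" "l < x"
  shows "(\<lambda>n. (G ^^ n) x) \<longlonglongrightarrow> a"
proof -
  define u where "u n = (G ^^ n) x" for n
  have u_Suc: "u (Suc n) = G (u n)" for n by (simp add: u_def)
  have lip: "\<bar>G y - G z\<bar> \<le> \<bar>y - z\<bar>" if "l < y" "l < z" for y z
    using contr[of y z] contr[of z y] that by (cases y z rule: linorder_cases) auto
  have limit: "b = a" if lim: "u \<longlonglongrightarrow> b" and l: "l < b" "\<And>n. l < u n" for b
  proof -
    have "(\<lambda>n. \<bar>u n - b\<bar>) \<longlonglongrightarrow> 0"
      using LIM_zero[OF lim] by (simp add: tendsto_rabs_zero)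
    then have "(\<lambda>n. G (u n) - G b) \<longlonglongrightarrow> 0"
      by (rule Lim_null_comparison[rotated]) (use lip l in auto)
    then have "(\<lambda>n. u (Suc n)) \<longlonglongrightarrow> G b" unfolding u_Suc by (rule LIM_zero_cancel)
    then have "G b = b" using LIMSEQ_Suc[OF lim] by (rule LIMSEQ_unique)
    then show "b = a"
      using contr[of a b] contr[of b a] fixpt l assms(3) by (cases a b rule: linorder_cases) auto
  qed
  show ?thesis
  proof (cases "a \<le> x")
    case True
    have bounds: "a \<le> u n" for n
    proof (induction n)
      case (Suc n)
      then show ?case using contr[of a "u n"] fixpt assms(3) by (cases "u n = a") (auto simp: u_Suc)
    qed (use True in \<open>simp add: u_def\<close>)
    have "u (Suc n) \<le> u n" for n
      using contr[of a "u n"] bounds[of n] fixpt assms(3) by (cases "u n = a") (auto simp: u_Suc)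
    then have "decseq u" by (rule decseq_SucI)
    then obtain b where b: "u \<longlonglongrightarrow> b" using decseq_convergent[of u a] bounds by blast
    have "a \<le> b" using b bounds by (intro LIMSEQ_le_const) auto
    then have "b = a" using limit[OF b] less_le_trans[OF assms(3)] bounds by blast
    with b show ?thesis by (simp add: u_def[abs_def])
  next
    case False
    have bounds: "l < u n \<and> x \<le> u n \<and> u n < a" for n
    proof (induction n)
      case (Suc n)
      then show ?case using contr[of "u n" a] fixpt by (auto simp: u_Suc)
    qed (use False assms in \<open>simp add: u_def\<close>)
    have "u n \<le> u (Suc n)" for n
      using contr[of "u n" a] bounds[of n] fixpt by (auto simp: u_Suc)
    then have "incseq u" by (rule incseq_SucI)
    moreover have "u n \<le> a" for n using bounds[of n] by simp
    ultimately obtain b where b: "u \<longlonglongrightarrow> b" using incseq_convergent[of u a] by blast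
    have "x \<le> b" using b bounds by (intro LIMSEQ_le_const) auto
    then have "b = a" using limit[OF b] less_le_trans[OF assms(4)] bounds by blast
    with b show ?thesis by (simp add: u_def[abs_def])
  qed
qed

locale escaping_nodes = two_nodes +
  assumes s_pos: "0 < s"
begin

lemma swapped_escaping: "escaping_nodes p1 q1 a1 p0 q0 a0 s"
  using s_pos by unfold_locales

lemma return_contracts:
  assumes "0 < y" "y < y'"
  shows "0 < return y' - return y" and "return y' - return y < y' - y"
proof -
  have L: "L.transit y < L.transit y'" "L.transit y' - L.transit y < y' - y"
    using L.transit_strict_mono[OF assms] L.transit_contracts[OF assms] .
  have pos: "0 < s + L.transit y" using s_pos L.transit_pos[OF assms(1)] by simp
  have less: "s + L.transit y < s + L.transit y'" using L by simp
  show "0 < return y' - return y"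
    using R.transit_strict_mono[OF pos less] by (simp add: return_def)
  show "return y' - return y < y' - y"
    using R.transit_contracts[OF pos less] L by (simp add: return_def)
qed

lemma return_greater: "0 < y \<Longrightarrow> s < return y"
  using R.transit_pos[of "s + L.transit y"] L.transit_pos[of y] s_pos by (simp add: return_def)

text \<open>
  Strictly decreasing distances alone do not force a fixed point on a half-line; Edelstein's theorem
  needs a compact invariant interval, which the bound on the right half return map provides.
\<close>

lemma return_fixpoint_exists: "\<exists>y>s. return y = y"
proof -
  define B where "B = s + a1 / q1"
  have "\<exists>!y\<in>{s..B}. return y = y"
  proof (rule Edelstein_fix)
    show "{s..B} \<noteq> {}" using R.a_pos R.q_pos by (simp add: B_def)
    show "return ` {s..B} \<subseteq> {s..B}"
    proof clarify
      fix y assume "y \<in> {s..B}"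
      then have y: "0 < y" using s_pos by simp
      have "0 < s + L.transit y" using L.transit_pos[OF y] s_pos by simp
      from R.transit_bounded[OF this] return_greater[OF y] show "return y \<in> {s..B}"
        by (simp add: return_def B_def)
    qed
    fix x y assume "x \<in> {s..B}" "y \<in> {s..B}"
    then show "x \<noteq> y \<longrightarrow> dist (return x) (return y) < dist x y"
      using return_contracts[of x y] return_contracts[of y x] s_pos
      by (cases x y rule: linorder_cases) (auto simp: dist_real_def)
  qed simp
  then obtain y where "y \<in> {s..B}" "return y = y" by blast
  with return_greater[of y] s_pos show ?thesis by force
qed

definition y_star :: real where "y_star = (SOME y. s < y \<and> return y = y)"

lemma y_star: "s < y_star" "return y_star = y_star" "0 < y_star"
  using someI_ex[of "\<lambda>y. s < y \<and> return y = y"] return_fixpoint_exists s_pos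
  by (auto simp: y_star_def)

lemma return_iterates_tendsto: "0 < y \<Longrightarrow> (\<lambda>n. (return ^^ n) y) \<longlonglongrightarrow> y_star"
  by (rule contraction_iterates_tendsto[of 0]) (use return_contracts y_star in auto)

lemma period_pos: "0 < y \<Longrightarrow> 0 < period y"
  using L.flight_pos[of y] R.flight_pos[of "s + L.transit y"] L.transit_pos[of y] s_pos
  by (simp add: period_def)

definition limit_cycle :: "(real \<times> real) set" where
  "limit_cycle = turn y_star ` {0..period y_star}"

text \<open>
  The finitely many crossing heights of a periodic orbit are mapped into themselves by an
  injective strict contraction, which leaves room for the fixed point only.
\<close>

lemma periodic_orbit_unique:
  assumes orbit: "crossing_periodic_orbit left_field right_field \<Gamma>"
  shows "\<Gamma> = limit_cycle"
proof -
  define U where "U = {y. max 0 s < y \<and> (0, y) \<in> \<Gamma>}"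
  note U = periodic_orbit_heights[OF orbit, folded U_def]
  have U_pos: "0 < y" if "y \<in> U" for y using that by (simp add: U_def)
  have only: "y = y_star" if "y \<in> U" for y
  proof (rule ccontr)
    assume "y \<noteq> y_star"
    define V where "V = (\<lambda>y. \<bar>y - y_star\<bar>) ` (U - {y_star})"
    have V: "finite V" "V \<noteq> {}" using U(1) that \<open>y \<noteq> y_star\<close> by (auto simp: V_def)
    have "\<exists>z. z \<in> U \<and> z \<noteq> y_star \<and> \<bar>z - y_star\<bar> = v" if "v \<in> V" for v
      using that by (auto simp: V_def)
    from this[OF Min_in[OF V]]
    obtain z where z: "z \<in> U" "z \<noteq> y_star" "\<bar>z - y_star\<bar> = Min V" by blast
    have "\<bar>return z - y_star\<bar> < \<bar>z - y_star\<bar>" "return z \<noteq> y_star"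
      using return_contracts[of z y_star] return_contracts[of y_star z] z(2) y_star U_pos[OF z(1)]
      by (cases z y_star rule: linorder_cases; auto)+
    moreover have "Min V \<le> \<bar>return z - y_star\<bar>"
      using U(3)[OF z(1)] \<open>return z \<noteq> y_star\<close> by (intro Min_le V) (auto simp: V_def)
    ultimately show False using z by simp
  qed
  obtain \<gamma> T where sol: "sol UNIV \<gamma>" and \<Gamma>: "\<Gamma> = range \<gamma>" and T: "0 < T" "\<And>t. \<gamma> (t + T) = \<gamma> t"
    using orbit unfolding crossing_periodic_orbit_def by blast
  have "y_star \<in> U" using U(2) only by blast
  then obtain t0 where t0: "\<gamma> t0 = (0, y_star)" by (auto simp: U_def \<Gamma>)
  define P where "P = period y_star"
  have P: "0 < P" unfolding P_def by (rule period_pos) (rule y_star)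
  have sol': "sol {t..} \<gamma>" for t by (rule sol_subset[OF sol]) simp
  have up: "max 0 s < y_star" using y_star by simp
  have turns: "\<gamma> (t0 + real n * P) = (0, y_star)" for n
  proof (induction n)
    case (Suc n)
    from sol_turn(3)[OF sol' Suc up] show ?case by (simp add: y_star P_def algebra_simps)
  qed (simp add: t0)
  have "\<gamma> t \<in> limit_cycle" for t
  proof -
    \<comment> \<open>Shift \<open>t\<close> by periods of the solution beyond \<open>t0\<close>, then locate it in a turn.\<close>
    have shift: "\<gamma> (t + real n * T) = \<gamma> t" for n
    proof (induction n)
      case (Suc n)
      then show ?case using T(2)[of "t + real n * T"] by (simp add: algebra_simps)
    qed simp
    obtain n where "t0 - t < real n * T" using T(1) reals_Archimedean3 by blast
    then have n: "t0 \<le> t + real n * T" by simp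
    have "filterlim (\<lambda>n. t0 + real n * P) at_top sequentially"
      using P by (intro filterlim_tendsto_add_at_top[OF tendsto_const]
          filterlim_at_top_mult_tendsto_pos[OF tendsto_const] filterlim_real_sequentially)
    from obtain_enclosing_index[OF this, of 0 "t + real n * T"] n
    obtain m where m: "t0 + real m * P \<le> t + real n * T" "t + real n * T < t0 + real (Suc m) * P"
      by auto
    have "\<gamma> (t + real n * T) = turn y_star (t + real n * T - (t0 + real m * P))"
      using sol_turn(2)[OF sol' turns up, of "t + real n * T - (t0 + real m * P)" m] m
      by (simp add: P_def algebra_simps)
    then show ?thesis
      using m unfolding shift limit_cycle_def by (auto simp: P_def algebra_simps)
  qed
  moreover have "turn y_star t \<in> range \<gamma>" if "t \<in> {0..period y_star}" for t
    using sol_turn(2)[OF sol' t0 up that] by (metis rangeI)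
  ultimately show ?thesis unfolding \<Gamma> limit_cycle_def by blast
qed

end

section \<open>The limit cycle and its stability\<close>

context escaping_nodes
begin

lemma left_arc_exists:
  assumes "L.entering z" "fst z = 0 \<Longrightarrow> s < snd z"
  shows "\<exists>\<tau> \<alpha>. 0 < \<tau> \<and> (fst z = 0 \<longrightarrow> L.flight s \<le> \<tau>) \<and> \<alpha> 0 = z \<and> sol {0..\<tau>} \<alpha> \<and>
    \<alpha> \<tau> \<in> crossing_points left_field right_field"
proof -
  obtain \<tau> where \<tau>: "0 < \<tau>" "fst (L.flow \<tau> z) = 0" "snd (L.flow \<tau> z) < 0"
    "\<And>t. 0 < t \<Longrightarrow> t < \<tau> \<Longrightarrow> fst (L.flow t z) < 0"
    using L.first_return[OF assms(1)] by blast
  have land: "snd (L.flow \<tau> z) < min 0 s" using \<tau> s_pos by simp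
  have "L.flight s \<le> \<tau>" if "fst z = 0"
  proof -
    from that have z: "z = (0, snd z)" by (simp add: prod_eq_iff)
    then have "snd z = L.height \<tau>"
      using L.fst_flow_axis_eq_0_iff[of \<tau> "snd z"] \<tau> by simp
    then have "L.flight (snd z) = \<tau>" using L.flight_height[OF \<tau>(1)] by simp
    then show ?thesis
      using assms(2)[OF that] L.flight_less_iff[of s "snd z"] s_pos by simp
  qed
  moreover have "sol {0..\<tau>} (\<lambda>t. L.flow t z)"
    using left_arc_is_sol[OF assms \<tau>(1,4,2) land] .
  moreover have "L.flow \<tau> z \<in> crossing_points left_field right_field"
    using \<tau> land by (simp add: crossing_iff)
  ultimately show ?thesis using \<tau>(1) by (intro exI[of _ \<tau>] exI[of _ "\<lambda>t. L.flow t z"]) simp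
qed

text \<open>
  Crossing points lie beyond height \<open>s\<close> in the coordinates of the arc that starts there, so this
  arc lasts longer than the one from height \<open>s > 0\<close>.
\<close>

lemma arc_exists:
  assumes "fst z \<noteq> 0 \<or> snd z < 0 \<or> s < snd z"
  shows "\<exists>\<tau> \<alpha>. 0 < \<tau> \<and> (fst z = 0 \<longrightarrow> min (L.flight s) (R.flight s) \<le> \<tau>) \<and> \<alpha> 0 = z \<and>
    sol {0..\<tau>} \<alpha> \<and> \<alpha> \<tau> \<in> crossing_points left_field right_field"
proof (cases "L.entering z \<and> (fst z = 0 \<longrightarrow> s < snd z)")
  case True
  with left_arc_exists[of z] show ?thesis by (metis min.coboundedI1)
next
  case False
  interpret swap: escaping_nodes p1 q1 a1 p0 q0 a0 s by (rule swapped_escaping)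
  have "R.entering (flip s z)" "fst (flip s z) = 0 \<Longrightarrow> s < snd (flip s z)"
    using False assms s_pos by (auto simp: L.entering_def R.entering_def)
  from swap.left_arc_exists[OF this]
  obtain \<tau> \<alpha> where *: "0 < \<tau>" "fst z = 0 \<Longrightarrow> R.flight s \<le> \<tau>" "\<alpha> 0 = flip s z"
    "swap.sol {0..\<tau>} \<alpha>" "\<alpha> \<tau> \<in> crossing_points swap.left_field swap.right_field"
    by auto
  have "flip s (\<alpha> \<tau>) \<in> crossing_points left_field right_field"
    using *(5) by (auto simp: swap.crossing_iff crossing_iff)
  with * crossing_solution_flip[OF *(4)] show ?thesis
    by (intro exI[of _ \<tau>] exI[of _ "\<lambda>t. flip s (\<alpha> t)"]) (simp add: min.coboundedI2)
qed

lemma forward_solution_exists: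
  assumes "fst z \<noteq> 0 \<or> snd z < 0 \<or> s < snd z"
  shows "\<exists>\<gamma>. sol {0..} \<gamma> \<and> \<gamma> 0 = z"
proof -
  let ?C = "crossing_points left_field right_field"
  have C: "?C \<subseteq> switching_line" by (auto simp: crossing_points_def)
  obtain \<tau> \<alpha> where \<alpha>: "0 < \<tau>" "\<alpha> 0 = z" "sol {0..\<tau>} \<alpha>" "\<alpha> \<tau> \<in> ?C"
    using arc_exists[OF assms] by blast
  have step: "\<exists>\<tau> \<alpha>. min (L.flight s) (R.flight s) \<le> \<tau> \<and> \<alpha> 0 = z \<and> sol {0..\<tau>} \<alpha> \<and> \<alpha> \<tau> \<in> ?C"
    if "z \<in> ?C" for z
  proof -
    from that s_pos have "fst z = 0" "snd z < 0 \<or> s < snd z" by (auto simp: crossing_iff)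
    then show ?thesis using arc_exists[of z] by blast
  qed
  have "0 < min (L.flight s) (R.flight s)"
    using s_pos L.flight_pos R.flight_pos by simp
  from crossing_solution_forever[of ?C, OF step this C \<alpha>(4)]
  obtain \<beta> where \<beta>: "sol {0..} \<beta>" "\<beta> 0 = \<alpha> \<tau>" by blast
  have "sol {0..} (\<lambda>t. if t \<le> \<tau> then \<alpha> t else \<beta> (t - \<tau>))"
    by (rule crossing_solution_prepend[OF \<alpha>(3) \<beta>(1)]) (use \<beta> \<alpha> C in auto)
  with \<alpha> show ?thesis
    by (intro exI[of _ "\<lambda>t. if t \<le> \<tau> then \<alpha> t else \<beta> (t - \<tau>)"]) simp
qed

text \<open>In flipped coordinates the right arc of the limit cycle starts at height \<open>v_star\<close>.\<close>

definition v_star :: real where "v_star = s + L.transit y_star"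

lemma v_star_pos: "0 < v_star"
  using L.transit_pos[OF y_star(3)] s_pos by (simp add: v_star_def)

lemma R_transit_v_star: "s + R.transit v_star = y_star"
  using y_star(2) by (simp add: return_def v_star_def)

lemma limit_cycle_arcs:
  "limit_cycle = (\<lambda>t. L.flow t (0, y_star)) ` {0..L.flight y_star}
     \<union> (\<lambda>t. flip s (R.flow t (0, v_star))) ` {0..R.flight v_star}" (is "_ = ?A \<union> ?B")
proof -
  define a b where "a = L.flight y_star" and "b = R.flight v_star"
  have pos: "0 < a" "0 < b"
    using L.flight_pos[OF y_star(3)] R.flight_pos[OF v_star_pos] by (simp_all add: a_def b_def)
  have per: "period y_star = a + b" by (simp add: period_def a_def b_def v_star_def)
  have turn: "turn y_star t = (if t \<le> a then L.flow t (0, y_star) else flip s (R.flow (t - a) (0, v_star)))"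
    for t by (simp add: turn_def a_def v_star_def)
  have joint: "flip s (R.flow 0 (0, v_star)) = turn y_star a"
    using L.flow_flight[OF y_star(3)] by (simp add: turn flip_def a_def v_star_def)
  have "?A = turn y_star ` {0..a}" by (simp add: turn a_def)
  moreover have "?B = turn y_star ` {a..a + b}"
  proof (intro equalityI image_subsetI)
    fix t assume t: "t \<in> {0..R.flight v_star}"
    have "flip s (R.flow t (0, v_star)) = turn y_star (a + t)"
      using joint t by (cases "t = 0") (auto simp: turn)
    then show "flip s (R.flow t (0, v_star)) \<in> turn y_star ` {a..a + b}"
      using t by (intro image_eqI[of _ _ "a + t"]) (auto simp: b_def)
  next
    fix t assume t: "t \<in> {a..a + b}"
    have "turn y_star t = flip s (R.flow (t - a) (0, v_star))"
      using joint t by (cases "t = a") (auto simp: turn)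
    then show "turn y_star t \<in> ?B"
      using t by (intro image_eqI[of _ _ "t - a"]) (auto simp: b_def)
  qed
  moreover have "{0..a + b} = {0..a} \<union> {a..a + b}" using pos by auto
  ultimately show ?thesis unfolding limit_cycle_def per by (simp only: image_Un)
qed

lemma compact_limit_cycle: "compact limit_cycle"
  unfolding limit_cycle_arcs
  by (intro compact_Un compact_continuous_image continuous_intros compact_Icc)

lemma limit_cycle_Int_switching_line:
  "limit_cycle \<inter> switching_line = {(0, y_star), (0, - L.transit y_star)}"
proof -
  have L: "z = (0, y_star) \<or> z = (0, - L.transit y_star)"
    if "z = L.flow t (0, y_star)" "t \<in> {0..L.flight y_star}" "fst z = 0" for z t
    using L.fst_flow_before_flight[OF y_star(3), of t] L.flow_flight[OF y_star(3)] that
    by (cases "t = 0 \<or> t = L.flight y_star") auto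
  have R: "z = (0, y_star) \<or> z = (0, - L.transit y_star)"
    if "z = flip s (R.flow t (0, v_star))" "t \<in> {0..R.flight v_star}" "fst z = 0" for z t
  proof (cases "t = 0 \<or> t = R.flight v_star")
    case True
    then show ?thesis
      using that R.flow_flight[OF v_star_pos] R_transit_v_star by (auto simp: flip_def v_star_def)
  next
    case False
    with R.fst_flow_before_flight[OF v_star_pos, of t] that show ?thesis by auto
  qed
  show ?thesis
  proof (intro equalityI subsetI)
    fix z assume "z \<in> limit_cycle \<inter> switching_line"
    then have "z \<in> limit_cycle" "fst z = 0" by (auto simp: switching_line_def)
    then show "z \<in> {(0, y_star), (0, - L.transit y_star)}"
      unfolding limit_cycle_arcs using L[of z] R[of z] by blast
  next
    have "L.flow 0 (0, y_star) \<in> limit_cycle" "L.flow (L.flight y_star) (0, y_star) \<in> limit_cycle"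
      unfolding limit_cycle_arcs using L.flight_pos[OF y_star(3)] by (intro UnI1 imageI, simp)+
    then have "{(0, y_star), (0, - L.transit y_star)} \<subseteq> limit_cycle"
      by (simp add: L.flow_flight[OF y_star(3)])
    moreover fix z :: "real \<times> real" assume "z \<in> {(0, y_star), (0, - L.transit y_star)}"
    ultimately show "z \<in> limit_cycle \<inter> switching_line" by (auto simp: switching_line_def)
  qed
qed

lemma turn_is_sol:
  assumes y: "s < y" shows "sol {0..period y} (turn y)"
proof -
  interpret swap: two_nodes p1 q1 a1 p0 q0 a0 s by (rule swapped)
  have y0: "0 < y" using y s_pos by simp
  define v where "v = s + L.transit y"
  have v: "s < v" "0 < v" using L.transit_pos[OF y0] s_pos by (simp_all add: v_def)
  define a b where "a = L.flight y" and "b = R.flight v"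
  have pos: "0 < a" "0 < b"
    using L.flight_pos[OF y0] R.flight_pos[OF v(2)] by (simp_all add: a_def b_def)
  have turn: "turn y t = (if t \<le> a then L.flow t (0, y) else flip s (R.flow (t - a) (0, v)))"
    for t by (simp add: turn_def a_def v_def)
  have joint: "turn y a = (0, - L.transit y)" "flip s (R.flow 0 (0, v)) = (0, - L.transit y)"
    using L.flow_flight[OF y0] by (simp_all add: turn flip_def a_def v_def)
  have "sol {0..a} (\<lambda>t. L.flow t (0, y))"
    using L.fst_flow_before_flight[OF y0] L.flow_flight[OF y0] L.transit_pos[OF y0] s_pos y pos
    by (intro left_arc_is_sol upper_entering) (auto simp: a_def)
  then have "sol {0..a} (turn y)" by (rule crossing_solution_cong) (simp add: turn)
  moreover have "swap.sol {0..b} (\<lambda>t. R.flow t (0, v))"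
    using R.fst_flow_before_flight[OF v(2)] R.flow_flight[OF v(2)] R.transit_pos[OF v(2)] s_pos v pos
    by (intro swap.left_arc_is_sol swap.upper_entering) (auto simp: b_def)
  then have "sol {0..b} (\<lambda>t. flip s (R.flow t (0, v)))" by (rule crossing_solution_flip)
  then have "sol {a..a + b} (\<lambda>t. flip s (R.flow (t - a) (0, v)))"
    by (rule crossing_solution_shift) auto
  then have "sol {a..a + b} (turn y)"
  proof (rule crossing_solution_cong)
    fix t assume "t \<in> {a..a + b}"
    then show "flip s (R.flow (t - a) (0, v)) = turn y t"
      using joint by (cases "t = a") (auto simp: turn)
  qed
  ultimately have "sol {0..a + b} (turn y)"
    by (rule crossing_solution_glue) (use joint pos in \<open>auto simp: switching_line_def\<close>)
  then show ?thesis by (simp add: period_def a_def b_def v_def)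
qed

lemma turn_ends:
  assumes "0 < y" shows "turn y 0 = (0, y)" "turn y (period y) = (0, return y)"
proof -
  have "0 < s + L.transit y" using L.transit_pos[OF assms] s_pos by simp
  then show "turn y (period y) = (0, return y)"
    using R.flow_flight[of "s + L.transit y"] R.flight_pos[of "s + L.transit y"]
    by (simp add: turn_def period_def return_def flip_def)
qed (use L.flight_pos[OF assms] in \<open>simp add: turn_def\<close>)

lemma limit_cycle_is_periodic_orbit:
  "crossing_periodic_orbit left_field right_field limit_cycle"
proof -
  define P where "P = period y_star"
  have P: "0 < P" unfolding P_def by (rule period_pos) (rule y_star)
  \<comment> \<open>The turn is extended periodically by reducing time modulo its duration.\<close>
  define \<gamma> where "\<gamma> t = turn y_star (t - of_int \<lfloor>t / P\<rfloor> * P)" for t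
  have ends: "turn y_star 0 = (0, y_star)" "turn y_star P = (0, y_star)"
    using turn_ends[OF y_star(3)] y_star(2) by (simp_all add: P_def)
  have shift: "\<gamma> (t + of_int k * P) = \<gamma> t" for t k
  proof -
    have "(t + of_int k * P) / P = t / P + of_int k" using P by (simp add: add_divide_distrib)
    then have "\<lfloor>(t + of_int k * P) / P\<rfloor> = \<lfloor>t / P\<rfloor> + k" by simp
    then show ?thesis by (simp add: \<gamma>_def algebra_simps)
  qed
  have first: "\<gamma> t = turn y_star t" if "t \<in> {0..P}" for t
  proof (cases "t = P")
    case True
    then show ?thesis using P ends by (simp add: \<gamma>_def)
  next
    case False
    with that P have "\<lfloor>t / P\<rfloor> = 0" by (simp add: floor_eq_iff)
    then show ?thesis by (simp add: \<gamma>_def)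
  qed
  have "sol {0..P} \<gamma>"
    using turn_is_sol[OF y_star(1)] unfolding P_def[symmetric]
    by (rule crossing_solution_cong) (simp add: first)
  then have piece: "sol {real n * P..real (Suc n) * P} \<gamma>" for n
  proof (rule crossing_solution_cong[OF crossing_solution_shift[of _ _ _ _ _ "real n * P"]])
    show "\<gamma> (t - real n * P) = \<gamma> t" for t
      using shift[of "t - real n * P" "int n"] by simp
  qed (auto simp: algebra_simps)
  have lim: "filterlim (\<lambda>n. real n * P) at_top sequentially"
    using P by (intro filterlim_at_top_mult_tendsto_pos[OF tendsto_const] filterlim_real_sequentially)
  have joints: "\<gamma> (real (Suc n) * P) \<in> switching_line" for n
    using shift[of 0 "int (Suc n)"] first[of 0] ends P by (simp add: switching_line_def)
  have "real n * P \<le> real (Suc n) * P" for n using P by (simp add: distrib_right)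
  then have "sol {real 0 * P..} \<gamma>"
    by (rule crossing_solution_chain[where T = "\<lambda>n. real n * P", OF piece joints _ lim])
  then have half_line: "sol {0..} \<gamma>" by simp
  have "sol UNIV \<gamma>"
  proof (rule crossing_solution_exhaust)
    fix r :: real
    obtain n where n: "r < real n * P" using P reals_Archimedean3 by blast
    have "sol {- (real n * P)..} (\<lambda>t. \<gamma> (t - - (real n * P)))"
      by (rule crossing_solution_shift[OF half_line]) simp
    moreover have "\<gamma> (t - - (real n * P)) = \<gamma> t" for t using shift[of t "int n"] by simp
    ultimately have "sol {- (real n * P)..} \<gamma>" by simp
    then show "sol (UNIV \<inter> {- r<..<r}) \<gamma>" by (rule sol_subset) (use n in auto)
  qed
  moreover have "\<gamma> (t + P) = \<gamma> t" for t using shift[of t 1] by simp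
  moreover have "limit_cycle = range \<gamma>"
  proof (intro equalityI subsetI)
    fix z assume "z \<in> limit_cycle"
    then obtain t where "z = turn y_star t" "t \<in> {0..P}"
      by (auto simp: limit_cycle_def P_def)
    then show "z \<in> range \<gamma>" using first[of t] by (metis rangeI)
  next
    fix z assume "z \<in> range \<gamma>"
    then obtain t where z: "z = turn y_star (t - of_int \<lfloor>t / P\<rfloor> * P)" by (auto simp: \<gamma>_def)
    have "of_int \<lfloor>t / P\<rfloor> \<le> t / P" "t / P \<le> of_int \<lfloor>t / P\<rfloor> + 1" by linarith+
    then have "of_int \<lfloor>t / P\<rfloor> * P \<le> t" "t \<le> of_int \<lfloor>t / P\<rfloor> * P + P"
      using P pos_le_divide_eq[OF P, of "of_int \<lfloor>t / P\<rfloor>" t]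
        pos_divide_le_eq[OF P, of t "of_int \<lfloor>t / P\<rfloor> + 1"]
      by (simp_all only: distrib_right mult_1)
    then show "z \<in> limit_cycle" unfolding z limit_cycle_def P_def[symmetric] by auto
  qed
  ultimately show ?thesis
    unfolding crossing_periodic_orbit_def limit_cycle_Int_switching_line using P by blast
qed

lemma turns_close:
  assumes "0 < e"
  obtains d where "0 < d"
    "\<And>y t. 0 < y \<Longrightarrow> \<bar>y - y_star\<bar> < d \<Longrightarrow> t \<in> {0..period y} \<Longrightarrow> infdist (turn y t) limit_cycle < e"
proof -
  obtain d where d: "0 < d" "\<And>y t. \<bar>y - y_star\<bar> < d \<Longrightarrow> t \<in> {0..L.flight y} \<Longrightarrow>
      \<exists>t'\<in>{0..L.flight y_star}. dist (L.flow t (0, y)) (L.flow t' (0, y_star)) < e"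
    using L.arcs_close[OF y_star(3) assms] by blast
  obtain d' where d': "0 < d'" "\<And>v t. \<bar>v - v_star\<bar> < d' \<Longrightarrow> t \<in> {0..R.flight v} \<Longrightarrow>
      \<exists>t'\<in>{0..R.flight v_star}. dist (R.flow t (0, v)) (R.flow t' (0, v_star)) < e"
    using R.arcs_close[OF v_star_pos assms] by blast
  show ?thesis
  proof
    show "0 < min d d'" using d d' by simp
    fix y t assume y: "0 < y" "\<bar>y - y_star\<bar> < min d d'" and t: "t \<in> {0..period y}"
    have "\<exists>z\<in>limit_cycle. dist (turn y t) z < e"
    proof (cases "t \<le> L.flight y")
      case True
      with d(2)[of y t] y t show ?thesis by (auto simp: limit_cycle_arcs turn_def)
    next
      case False
      have "\<bar>(s + L.transit y) - v_star\<bar> \<le> \<bar>y - y_star\<bar>"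
        using L.transit_strict_mono[of y y_star] L.transit_contracts[of y y_star]
          L.transit_strict_mono[of y_star y] L.transit_contracts[of y_star y] y y_star(3)
        by (cases y y_star rule: linorder_cases) (auto simp: v_star_def)
      then have "\<exists>t'\<in>{0..R.flight v_star}.
          dist (R.flow (t - L.flight y) (0, s + L.transit y)) (R.flow t' (0, v_star)) < e"
        using False t y by (intro d') (auto simp: period_def)
      then obtain t' where t': "t' \<in> {0..R.flight v_star}"
        "dist (flip s (R.flow (t - L.flight y) (0, s + L.transit y))) (flip s (R.flow t' (0, v_star))) < e"
        by auto
      have "flip s (R.flow t' (0, v_star)) \<in> limit_cycle"
        unfolding limit_cycle_arcs using t'(1) by blast
      moreover have "dist (turn y t) (flip s (R.flow t' (0, v_star))) < e"
        using t'(2) False by (simp add: turn_def)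
      ultimately show ?thesis by blast
    qed
    then show "infdist (turn y t) limit_cycle < e" by (meson infdist_le le_less_trans)
  qed
qed

text \<open>
  The solution passes the upper crossing points at the iterates of the return map, which tend to
  \<open>y_star\<close>; in between it follows whole turns, which are then uniformly close to the limit cycle.
\<close>

lemma sol_converges:
  assumes sol: "sol {0..} \<gamma>"
  shows "((\<lambda>t. infdist (\<gamma> t) limit_cycle) \<longlongrightarrow> 0) at_top"
proof -
  obtain t1 y where t1: "0 \<le> t1" and y: "max 0 s < y" and start: "\<gamma> t1 = (0, y)"
    by (rule sol_reaches_upper[OF sol])
  define u where "u n = (return ^^ n) y" for n
  define T where "T n = t1 + (\<Sum>k<n. period (u k))" for n
  have u_Suc: "u (Suc n) = return (u n)" and T_Suc: "T (Suc n) = T n + period (u n)" for n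
    by (simp_all add: u_def T_def)
  have u: "s < u n" for n
  proof (induction n)
    case (Suc n)
    then show ?case using return_greater[of "u n"] s_pos by (simp add: u_Suc)
  qed (use y in \<open>simp add: u_def\<close>)
  then have u0: "0 < u n" for n using less_trans[OF s_pos] by blast
  have umax: "max 0 s < u n" for n using u0[of n] u[of n] by simp
  define c where "c = L.flight s"
  have c: "0 < c" unfolding c_def by (rule L.flight_pos[OF s_pos])
  have per: "c \<le> period (u n)" for n
  proof -
    have "c < L.flight (u n)" unfolding c_def using L.flight_less_iff[OF s_pos u0] u by simp
    moreover have "0 < s + L.transit (u n)" using L.transit_pos[OF u0[of n]] s_pos by simp
    then have "0 < R.flight (s + L.transit (u n))" by (rule R.flight_pos)
    ultimately show ?thesis by (simp add: period_def)
  qed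
  have growth: "real n * c \<le> T n" for n
  proof (induction n)
    case (Suc n)
    then show ?case using per[of n] by (simp add: T_Suc distrib_right)
  qed (use t1 in \<open>simp add: T_def\<close>)
  have T0: "0 \<le> T n" for n using growth[of n] c by (smt (verit) mult_nonneg_nonneg of_nat_0_le_iff)
  have "filterlim (\<lambda>n. real n * c) at_top sequentially"
    using c by (intro filterlim_at_top_mult_tendsto_pos[OF tendsto_const] filterlim_real_sequentially)
  then have T_lim: "filterlim T at_top sequentially"
    by (rule filterlim_at_top_mono) (simp add: growth)
  have sol_from: "sol {T n..} \<gamma>" for n using T0[of n] by (intro sol_subset[OF sol]) auto
  have at_T: "\<gamma> (T n) = (0, u n)" for n
  proof (induction n)
    case (Suc n)
    from sol_turn(3)[OF sol_from Suc umax] show ?case by (simp add: T_Suc u_Suc)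
  qed (simp add: T_def u_def start)
  show ?thesis
  proof (rule tendstoI)
    fix e :: real assume "0 < e"
    then obtain d where d: "0 < d"
      "\<And>y t. 0 < y \<Longrightarrow> \<bar>y - y_star\<bar> < d \<Longrightarrow> t \<in> {0..period y} \<Longrightarrow> infdist (turn y t) limit_cycle < e"
      using turns_close by blast
    have "u \<longlonglongrightarrow> y_star"
      using return_iterates_tendsto[of y] y by (simp add: u_def[abs_def])
    from tendstoD[OF this d(1)] obtain N where N: "\<And>n. N \<le> n \<Longrightarrow> \<bar>u n - y_star\<bar> < d"
      by (auto simp: eventually_sequentially dist_real_def)
    have "infdist (\<gamma> t) limit_cycle < e" if t: "T N \<le> t" for t
    proof -
      obtain n where n: "N \<le> n" "T n \<le> t" "t < T (Suc n)"
        by (rule obtain_enclosing_index[OF T_lim t])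
      have in_turn: "t - T n \<in> {0..period (u n)}" using n by (simp add: T_Suc)
      have "\<gamma> t = turn (u n) (t - T n)"
        using sol_turn(2)[OF sol_from at_T umax in_turn] by simp
      with d(2)[OF u0 N[OF n(1)] in_turn] show ?thesis by simp
    qed
    then show "eventually (\<lambda>t. dist (infdist (\<gamma> t) limit_cycle) 0 < e) at_top"
      by (auto simp: eventually_at_top_linorder dist_real_def infdist_nonneg)
  qed
qed

text \<open>
  The limit cycle keeps a positive distance from the closed escaping segment, which consists of
  the points where no solution starts. Everywhere else solutions exist and converge.
\<close>

lemma stable_limit_cycle: "stable_orbit left_field right_field limit_cycle"
proof -
  let ?B = "{0} \<times> {0..s}"
  have "compact ?B" by (intro compact_Times) auto
  moreover have "closed limit_cycle" using compact_limit_cycle by (rule compact_imp_closed)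
  moreover have "?B \<inter> limit_cycle = {}"
  proof -
    have "?B \<subseteq> switching_line" by (auto simp: switching_line_def)
    then have "?B \<inter> limit_cycle \<subseteq> ?B \<inter> {(0, y_star), (0, - L.transit y_star)}"
      using limit_cycle_Int_switching_line by blast
    also have "\<dots> = {}" using y_star L.transit_pos[OF y_star(3)] by auto
    finally show ?thesis by blast
  qed
  ultimately obtain d where d: "0 < d" "\<And>x y. x \<in> ?B \<Longrightarrow> y \<in> limit_cycle \<Longrightarrow> d \<le> dist x y"
    using separate_compact_closed by metis
  have "limit_cycle \<noteq> {}" using limit_cycle_Int_switching_line by blast
  then have far: "d \<le> infdist p limit_cycle" if "p \<in> ?B" for p
    using infdist_attains_inf[OF \<open>closed limit_cycle\<close>, of p] d(2)[OF that] by metis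
  have off: "fst p \<noteq> 0 \<or> snd p < 0 \<or> s < snd p" if "infdist p limit_cycle < d" for p
  proof (rule ccontr)
    assume "\<not> (fst p \<noteq> 0 \<or> snd p < 0 \<or> s < snd p)"
    then have "p \<in> ?B" by (auto simp: mem_Times_iff)
    with far that show False by fastforce
  qed
  show ?thesis
    unfolding stable_orbit_def using d(1) off forward_solution_exists sol_converges by blast
qed

end

section \<open>The region enclosed by the limit cycle\<close>

text \<open>
  A connected set that meets the open region between two graphs with common ends and leaves it
  has to meet the frontier of the region, which consists of the graphs.
\<close>

lemma between_graphs_inside:
  fixes \<phi> \<psi> :: "real \<Rightarrow> real"
  assumes cont: "continuous_on {c..d} \<phi>" "continuous_on {c..d} \<psi>"
    and ends: "\<phi> c = \<psi> c" "\<phi> d = \<psi> d"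
    and \<Gamma>: "\<Gamma> = (\<lambda>v. (\<phi> v, v)) ` {c..d} \<union> (\<lambda>v. (\<psi> v, v)) ` {c..d}"
    and v: "c < v" "v < d" and x: "\<phi> v < x" "x < \<psi> v"
  shows "(x, v) \<in> inside \<Gamma>"
proof -
  define K where "K = (UNIV \<times> {c<..<d}) \<inter> (\<lambda>z. fst z - \<phi> (snd z)) -` {0<..}
    \<inter> ((UNIV \<times> {c<..<d}) \<inter> (\<lambda>z. \<psi> (snd z) - fst z) -` {0<..})"
  define C where "C = (UNIV \<times> {c..d}) \<inter> (\<lambda>z. fst z - \<phi> (snd z)) -` {0..}
    \<inter> ((UNIV \<times> {c..d}) \<inter> (\<lambda>z. \<psi> (snd z) - fst z) -` {0..})"
  have cont_diff: "continuous_on (UNIV \<times> S) (\<lambda>z. fst z - \<phi> (snd z))"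
    "continuous_on (UNIV \<times> S) (\<lambda>z. \<psi> (snd z) - fst z)" if "S \<subseteq> {c..d}" for S
    using that by (auto intro!: continuous_intros continuous_on_compose2[OF cont(1)]
        continuous_on_compose2[OF cont(2)])
  have "open K" unfolding K_def
    by (intro open_Int continuous_open_preimage cont_diff open_Times) auto
  have "closed C" unfolding C_def
    by (intro closed_Int continuous_closed_preimage cont_diff closed_Times) auto
  have "K \<subseteq> C" by (auto simp: K_def C_def)
  then have "closure K \<subseteq> C" using \<open>closed C\<close> by (rule closure_minimal)
  have "C - K \<subseteq> \<Gamma>"
  proof
    fix z assume z: "z \<in> C - K"
    then have bounds: "c \<le> snd z" "snd z \<le> d" "\<phi> (snd z) \<le> fst z" "fst z \<le> \<psi> (snd z)"
      by (auto simp: C_def)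
    have "fst z = \<phi> (snd z) \<or> fst z = \<psi> (snd z)"
    proof (cases "snd z = c \<or> snd z = d")
      case True
      with bounds ends show ?thesis by auto
    next
      case False
      with z bounds show ?thesis by (auto simp: K_def mem_Times_iff)
    qed
    then have "z = (\<phi> (snd z), snd z) \<or> z = (\<psi> (snd z), snd z)" by (simp add: prod_eq_iff)
    moreover have "snd z \<in> {c..d}" using bounds by simp
    ultimately show "z \<in> \<Gamma>" unfolding \<Gamma> by blast
  qed
  then have frontier: "frontier K \<subseteq> \<Gamma>"
    using \<open>closure K \<subseteq> C\<close> interior_open[OF \<open>open K\<close>] by (auto simp: frontier_def)
  have off: "K \<inter> \<Gamma> = {}" by (auto simp: K_def \<Gamma>)
  have xv: "(x, v) \<in> K" using v x by (simp add: K_def)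
  have "bounded (\<phi> ` {c..d})" "bounded (\<psi> ` {c..d})"
    by (intro compact_imp_bounded compact_continuous_image cont compact_Icc)+
  then obtain m M where mM: "\<And>v. v \<in> {c..d} \<Longrightarrow> \<bar>\<phi> v\<bar> \<le> m" "\<And>v. v \<in> {c..d} \<Longrightarrow> \<bar>\<psi> v\<bar> \<le> M"
    unfolding bounded_iff real_norm_def by (metis imageI)
  have "K \<subseteq> {- m..M} \<times> {c..d}"
  proof
    fix z assume "z \<in> K"
    then have "snd z \<in> {c..d}" "\<phi> (snd z) < fst z" "fst z < \<psi> (snd z)" by (auto simp: K_def)
    then show "z \<in> {- m..M} \<times> {c..d}"
      using mM(1)[of "snd z"] mM(2)[of "snd z"] by (auto simp: mem_Times_iff)
  qed
  then have "bounded K" by (rule bounded_subset[rotated]) (intro bounded_Times bounded_closed_interval)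
  define W where "W = connected_component_set (- \<Gamma>) (x, v)"
  have "W \<subseteq> - \<Gamma>" unfolding W_def by (rule connected_component_subset)
  have "(x, v) \<in> W" unfolding W_def using xv off by (auto intro: connected_component_refl)
  have "W \<subseteq> K"
  proof (rule ccontr)
    assume "\<not> W \<subseteq> K"
    then have "W - K \<noteq> {}" by blast
    moreover have "W \<inter> K \<noteq> {}" using \<open>(x, v) \<in> W\<close> xv by blast
    moreover have "connected W" unfolding W_def by (rule connected_connected_component)
    ultimately have "W \<inter> frontier K \<noteq> {}" by (intro connected_Int_frontier)
    then show False using frontier \<open>W \<subseteq> - \<Gamma>\<close> by blast
  qed
  then have "bounded W" using \<open>bounded K\<close> bounded_subset by blast
  moreover have "(x, v) \<notin> \<Gamma>" using xv off by blast
  ultimately show ?thesis by (simp add: inside_def W_def)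
qed

context node
begin

text \<open>The second coordinate decreases along an arc, so the arc is a graph over the line \<open>x = 0\<close>.\<close>

lemma arc_is_graph:
  assumes y: "0 < y"
  obtains \<phi> where "continuous_on {- transit y..y} \<phi>"
    "(\<lambda>t. flow t (0, y)) ` {0..flight y} = (\<lambda>v. (\<phi> v, v)) ` {- transit y..y}"
    "\<phi> y = 0" "\<phi> (- transit y) = 0"
    "\<And>v. - transit y < v \<Longrightarrow> v < y \<Longrightarrow> \<phi> v < 0"
proof -
  define g where "g = (\<lambda>t. snd (flow t (0, y)))"
  define I where "I = {0..flight y}"
  have fp: "0 < flight y" using y by (rule flight_pos)
  have g_ends: "g 0 = y" "g (flight y) = - transit y"
    using flow_flight[OF y] by (simp_all add: g_def)
  have decr: "g t' < g t" if "t \<in> I" "t' \<in> I" "t < t'" for t t'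
    unfolding g_def using that fst_flow_before_flight[OF y]
    by (intro snd_flow_decreasing[of "flight y"]) (auto simp: I_def)
  have cont: "continuous_on I g" unfolding g_def by (intro continuous_intros)
  have inj: "inj_on g I"
    by (rule inj_onI) (metis decr less_irrefl linorder_less_linear)
  have decr_le: "g t' \<le> g t" if "t \<in> I" "t' \<in> I" "t \<le> t'" for t t'
    using decr[OF that(1,2)] that(3) by (cases "t = t'") auto
  have image: "g ` I = {- transit y..y}"
  proof (intro equalityI subsetI)
    fix v assume "v \<in> g ` I"
    then obtain t where "t \<in> I" "v = g t" by blast
    then show "v \<in> {- transit y..y}"
      using decr_le[of 0 t] decr_le[of t "flight y"] g_ends fp by (simp add: I_def)
  next
    fix v assume "v \<in> {- transit y..y}"
    then have "\<exists>t. 0 \<le> t \<and> t \<le> flight y \<and> g t = v"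
      using cont fp by (intro IVT2') (auto simp: g_ends I_def)
    then show "v \<in> g ` I" by (auto simp: I_def)
  qed
  define \<theta> where "\<theta> = the_inv_into I g"
  have \<theta>_g: "\<theta> (g t) = t" if "t \<in> I" for t
    unfolding \<theta>_def by (rule the_inv_into_f_f[OF inj that])
  define \<phi> where "\<phi> v = fst (flow (\<theta> v) (0, y))" for v
  have \<phi>_g: "(\<phi> (g t), g t) = flow t (0, y)" if "t \<in> I" for t
    using \<theta>_g[OF that] by (simp add: \<phi>_def g_def prod_eq_iff)
  have "continuous_on (g ` I) \<theta>"
    by (rule continuous_on_inv[OF cont]) (simp_all add: I_def \<theta>_g[unfolded I_def])
  then have "continuous_on {- transit y..y} \<phi>"
    unfolding \<phi>_def image by (intro continuous_intros)
  moreover have "(\<lambda>t. flow t (0, y)) ` I = (\<lambda>v. (\<phi> v, v)) ` {- transit y..y}"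
    unfolding image[symmetric] image_image by (rule image_cong[OF refl]) (simp add: \<phi>_g)
  moreover have "\<phi> y = 0" "\<phi> (- transit y) = 0"
    using \<phi>_g[of 0] \<phi>_g[of "flight y"] fp flow_flight[OF y] by (simp_all add: g_ends I_def)
  moreover have "\<phi> v < 0" if v: "- transit y < v" "v < y" for v
  proof -
    have "v \<in> g ` I" using v by (simp add: image)
    then obtain t where t: "t \<in> I" "v = g t" by blast
    then have "t \<noteq> 0" "t \<noteq> flight y" using v g_ends by auto
    then show ?thesis
      using t \<phi>_g[OF t(1)] fst_flow_before_flight[OF y, of t] by (auto simp: I_def dest: arg_cong[of _ _ fst])
  qed
  ultimately show ?thesis unfolding I_def by (rule that)
qed

end

context escaping_nodes
begin

lemma limit_cycle_surrounds: "surrounds limit_cycle {(0, y) |y. 0 < y \<and> y < s}"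
proof -
  define m where "m = L.transit y_star"
  have ends: "s - v_star = - m" "s + R.transit v_star = y_star"
    using R_transit_v_star by (simp_all add: v_star_def m_def)
  obtain \<phi> where \<phi>: "continuous_on {- m..y_star} \<phi>"
    "(\<lambda>t. L.flow t (0, y_star)) ` {0..L.flight y_star} = (\<lambda>v. (\<phi> v, v)) ` {- m..y_star}"
    "\<phi> y_star = 0" "\<phi> (- m) = 0" "\<And>v. - m < v \<Longrightarrow> v < y_star \<Longrightarrow> \<phi> v < 0"
    using L.arc_is_graph[OF y_star(3)] unfolding m_def by blast
  obtain \<eta> where \<eta>: "continuous_on {- R.transit v_star..v_star} \<eta>"
    "(\<lambda>t. R.flow t (0, v_star)) ` {0..R.flight v_star} = (\<lambda>v. (\<eta> v, v)) ` {- R.transit v_star..v_star}"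
    "\<eta> v_star = 0" "\<eta> (- R.transit v_star) = 0"
    "\<And>v. - R.transit v_star < v \<Longrightarrow> v < v_star \<Longrightarrow> \<eta> v < 0"
    using R.arc_is_graph[OF v_star_pos] by blast
  define \<psi> where "\<psi> v = - \<eta> (s - v)" for v
  have "(\<lambda>t. flip s (R.flow t (0, v_star))) ` {0..R.flight v_star}
      = flip s ` (\<lambda>v. (\<eta> v, v)) ` {- R.transit v_star..v_star}"
    unfolding \<eta>(2)[symmetric] by (simp add: image_image)
  also have "\<dots> = (\<lambda>v. (\<psi> v, v)) ` (\<lambda>v. s - v) ` {- R.transit v_star..v_star}"
    unfolding image_image by (rule image_cong[OF refl]) (simp add: \<psi>_def flip_def)
  also have "(\<lambda>v. s - v) ` {- R.transit v_star..v_star} = {- m..y_star}"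
    using ends by simp
  finally have right: "(\<lambda>t. flip s (R.flow t (0, v_star))) ` {0..R.flight v_star}
      = (\<lambda>v. (\<psi> v, v)) ` {- m..y_star}" .
  have cont: "continuous_on {- m..y_star} \<psi>"
    unfolding \<psi>_def using ends
    by (intro continuous_intros continuous_on_compose2[OF \<eta>(1)]) auto
  have same_ends: "\<phi> (- m) = \<psi> (- m)" "\<phi> y_star = \<psi> y_star"
  proof -
    have "s - - m = v_star" "s - y_star = - R.transit v_star" using ends by simp_all
    then show "\<phi> (- m) = \<psi> (- m)" "\<phi> y_star = \<psi> y_star" using \<phi>(3,4) \<eta>(3,4) by (simp_all add: \<psi>_def)
  qed
  have graphs: "limit_cycle = (\<lambda>v. (\<phi> v, v)) ` {- m..y_star} \<union> (\<lambda>v. (\<psi> v, v)) ` {- m..y_star}"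
    unfolding limit_cycle_arcs \<phi>(2) right ..
  show ?thesis
    unfolding surrounds_def
  proof clarify
    fix y assume y: "0 < y" "y < s"
    then have bounds: "- m < y" "y < y_star"
      using y_star(1) L.transit_pos[OF y_star(3)] by (simp_all add: m_def)
    have "\<phi> y < 0" using \<phi>(5) bounds by simp
    moreover have "0 < \<psi> y" using \<eta>(5)[of "s - y"] ends bounds by (simp add: \<psi>_def)
    ultimately show "(0, y) \<in> inside limit_cycle"
      by (rule between_graphs_inside[OF \<phi>(1) cont same_ends graphs bounds])
  qed
qed

end

section \<open>The Welander system\<close>

lemma welander_L_eq_node:
  "welander_L \<alpha> \<beta> \<epsilon> k0 = node.field (1 + k0) (k0 + \<beta>) (welander_a \<alpha> \<beta> \<epsilon> k0)"
  if "node (1 + k0) (k0 + \<beta>) (welander_a \<alpha> \<beta> \<epsilon> k0)"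
  unfolding welander_L_def node.field_def[OF that] by (auto simp: fun_eq_iff algebra_simps)

lemma welander_R_eq_mirrored_node:
  "welander_R \<alpha> \<beta> \<epsilon> k0 k1
     = mirrored ((k0 - k1) * \<epsilon>) (node.field (1 + k1) (k1 + \<beta>) (- welander_a \<alpha> \<beta> \<epsilon> k1))"
  if "node (1 + k1) (k1 + \<beta>) (- welander_a \<alpha> \<beta> \<epsilon> k1)"
  unfolding welander_R_def mirrored_def node.field_def[OF that]
  by (auto simp: fun_eq_iff algebra_simps)

text \<open>
  With this factorisation the hypotheses on \<open>\<alpha>\<close> become \<open>welander_a \<alpha> \<beta> \<epsilon> k0 > 0\<close> and
  \<open>welander_a \<alpha> \<beta> \<epsilon> k1 < 0\<close>, that is, both equilibria are virtual.
\<close>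

lemma welander_a_eq:
  "k + \<beta> \<noteq> 0 \<Longrightarrow> welander_a \<alpha> \<beta> \<epsilon> k = (k + \<beta>) * (welander_alpha \<beta> \<epsilon> k - \<alpha>)"
  by (simp add: welander_a_def welander_alpha_def right_diff_distrib) (simp add: algebra_simps)

lemma contains_segment_nonempty: "contains_segment S \<Longrightarrow> S \<noteq> {}"
  unfolding contains_segment_def by (metis open_segment_eq_empty subset_empty)

lemma contains_segment_axis:
  assumes "c < d" shows "contains_segment {(0::real, y) |y. c < y \<and> y < (d::real)}"
proof -
  have "open_segment (0::real, c) (0, d) \<subseteq> {(0, y) |y. c < y \<and> y < d}"
  proof
    fix z assume "z \<in> open_segment (0::real, c) (0, d)"
    then obtain u where u: "0 < u" "u < 1" "z = (1 - u) *\<^sub>R (0, c) + u *\<^sub>R (0, d)"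
      by (auto simp: in_segment)
    have "z = (0, c + u * (d - c))" using u by (simp add: algebra_simps)
    moreover have "0 < u * (d - c)" "u * (d - c) < 1 * (d - c)"
      using u assms by (simp_all add: mult_strict_right_mono)
    ultimately show "z \<in> {(0, y) |y. c < y \<and> y < d}" by auto
  qed
  moreover have "(0::real, c) \<noteq> (0, d)" using assms by simp
  ultimately show ?thesis unfolding contains_segment_def by blast
qed

lemma contains_segment_axis_iff:
  "contains_segment {(0::real, y) |y. c < y \<and> y < (d::real)} \<longleftrightarrow> c < d"
proof
  assume "contains_segment {(0::real, y) |y. c < y \<and> y < d}"
  from contains_segment_nonempty[OF this] show "c < d" by auto
qed (rule contains_segment_axis)

theorem proposition17:
  fixes \<alpha> \<beta> \<epsilon> k0 k1 :: real
  defines "X \<equiv> welander_L \<alpha> \<beta> \<epsilon> k0"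
    and "Y \<equiv> welander_R \<alpha> \<beta> \<epsilon> k0 k1"
  assumes "\<beta> > 0" and "0 \<le> k0" and "k0 < k1" and "\<alpha> * (1 - \<beta>) \<noteq> 0"
    and "\<alpha> < welander_alpha \<beta> \<epsilon> k0" and "\<alpha> > welander_alpha \<beta> \<epsilon> k1"
  shows "(contains_segment (sliding_points X Y) \<longleftrightarrow> \<epsilon> > 0) \<and>
    (\<not> contains_segment (sliding_points X Y) \<and> \<not> contains_segment (escaping_points X Y)
       \<longleftrightarrow> \<epsilon> = 0) \<and>
    (contains_segment (escaping_points X Y) \<longleftrightarrow> \<epsilon> < 0) \<and>
    (contains_segment (sliding_points X Y) \<or>
     \<not> contains_segment (sliding_points X Y) \<and> \<not> contains_segment (escaping_points X Y)
       \<longrightarrow> \<not> (\<exists>\<Gamma>. crossing_periodic_orbit X Y \<Gamma>)) \<and>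
    (contains_segment (escaping_points X Y) \<longrightarrow>
       escaping_points X Y = {(0, y) | y. 0 < y \<and> y < (k0 - k1) * \<epsilon>} \<and>
       (\<exists>!\<Gamma>. crossing_periodic_orbit X Y \<Gamma>) \<and>
       (\<forall>\<Gamma>. crossing_periodic_orbit X Y \<Gamma> \<longrightarrow>
          stable_orbit X Y \<Gamma> \<and>
          surrounds \<Gamma> {(0, y) | y. 0 < y \<and> y < (k0 - k1) * \<epsilon>}))"
proof -
  define s where "s = (k0 - k1) * \<epsilon>"
  have s_sign: "0 < s \<longleftrightarrow> \<epsilon> < 0" "s < 0 \<longleftrightarrow> 0 < \<epsilon>"
    using \<open>k0 < k1\<close> by (auto simp: s_def zero_less_mult_iff mult_less_0_iff)
  have sliding: "sliding_points X Y = {(0, y) |y. s < y \<and> y < 0}"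
    by (auto simp: sliding_points_def switching_line_def X_def Y_def welander_L_def welander_R_def s_def)
  have escaping: "escaping_points X Y = {(0, y) |y. 0 < y \<and> y < s}"
    by (auto simp: escaping_points_def switching_line_def X_def Y_def welander_L_def welander_R_def s_def)
  have segments: "contains_segment (sliding_points X Y) \<longleftrightarrow> 0 < \<epsilon>"
    "contains_segment (escaping_points X Y) \<longleftrightarrow> \<epsilon> < 0"
    unfolding sliding escaping contains_segment_axis_iff s_sign by (rule refl)+
  have pos: "0 < k0 + \<beta>" "0 < k1 + \<beta>" "\<beta> \<noteq> 1" using assms by auto
  then have "0 < welander_a \<alpha> \<beta> \<epsilon> k0" "welander_a \<alpha> \<beta> \<epsilon> k1 < 0"
    using assms by (simp_all add: welander_a_eq mult_pos_neg)
  then have nodes: "node (1 + k0) (k0 + \<beta>) (welander_a \<alpha> \<beta> \<epsilon> k0)"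
    "node (1 + k1) (k1 + \<beta>) (- welander_a \<alpha> \<beta> \<epsilon> k1)"
    using assms pos by (auto simp: node_def)
  interpret two_nodes "1 + k0" "k0 + \<beta>" "welander_a \<alpha> \<beta> \<epsilon> k0" "1 + k1" "k1 + \<beta>"
    "- welander_a \<alpha> \<beta> \<epsilon> k1" s
    using nodes by (simp add: two_nodes_def)
  have fields: "X = left_field" "Y = right_field"
    using welander_L_eq_node[OF nodes(1)] welander_R_eq_mirrored_node[OF nodes(2)]
    by (simp_all add: X_def Y_def s_def)
  have none: "\<not> crossing_periodic_orbit X Y \<Gamma>" if "0 \<le> \<epsilon>" for \<Gamma>
    unfolding fields using that s_sign by (intro no_periodic_orbit) auto
  have unique: "(\<exists>!\<Gamma>. crossing_periodic_orbit X Y \<Gamma>) \<and>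
      (\<forall>\<Gamma>. crossing_periodic_orbit X Y \<Gamma> \<longrightarrow>
        stable_orbit X Y \<Gamma> \<and> surrounds \<Gamma> {(0, y) | y. 0 < y \<and> y < s})"
    if "\<epsilon> < 0"
  proof -
    interpret escaping_nodes "1 + k0" "k0 + \<beta>" "welander_a \<alpha> \<beta> \<epsilon> k0" "1 + k1" "k1 + \<beta>"
      "- welander_a \<alpha> \<beta> \<epsilon> k1" s
      using that s_sign by unfold_locales simp
    show ?thesis
      unfolding fields
    proof (intro conjI allI impI)
      show "\<exists>!\<Gamma>. crossing_periodic_orbit left_field right_field \<Gamma>"
        by (rule ex1I[of _ limit_cycle], rule limit_cycle_is_periodic_orbit,
            rule periodic_orbit_unique)
      fix \<Gamma> assume "crossing_periodic_orbit left_field right_field \<Gamma>"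
      then have \<Gamma>: "\<Gamma> = limit_cycle" by (rule periodic_orbit_unique)
      show "stable_orbit left_field right_field \<Gamma>" unfolding \<Gamma> by (rule stable_limit_cycle)
      show "surrounds \<Gamma> {(0, y) |y. 0 < y \<and> y < s}" unfolding \<Gamma> by (rule limit_cycle_surrounds)
    qed
  qed
  have none': "\<not> (\<exists>\<Gamma>. crossing_periodic_orbit X Y \<Gamma>)" if "\<not> \<epsilon> < 0"
    using none that by simp
  show ?thesis
    unfolding segments s_def[symmetric]
  proof (intro conjI)
    show "\<epsilon> < 0 \<longrightarrow> escaping_points X Y = {(0, y) |y. 0 < y \<and> y < s} \<and>
      (\<exists>!\<Gamma>. crossing_periodic_orbit X Y \<Gamma>) \<and>
      (\<forall>\<Gamma>. crossing_periodic_orbit X Y \<Gamma> \<longrightarrow>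
        stable_orbit X Y \<Gamma> \<and> surrounds \<Gamma> {(0, y) | y. 0 < y \<and> y < s})"
      using escaping unique by (intro impI conjI) simp_all
    show "0 < \<epsilon> \<or> \<not> 0 < \<epsilon> \<and> \<not> \<epsilon> < 0 \<longrightarrow> \<not> (\<exists>\<Gamma>. crossing_periodic_orbit X Y \<Gamma>)"
      using none' by (meson less_asym)
  qed auto
qed

end
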